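(* Let $0 \le \underline{\sigma} \le \overline{\sigma} < \infty$ with $\overline{\sigma}>0$, and let $c \in \mathbb{R}$. Consider the following Cauchy problem for the G-heat equation, $$u_t = \tfrac12\left(\overline{\sigma}^2 (u_{xx})^+ - \underline{\sigma}^2 (u_{xx})^-\right),\qquad u(0,x) = \mathbf{1}(x>c).$$ The solution is given by $u(t,x) = f\{(x-c)/\sqrt{t}\}$, where $$f(y) = f(y;\underline{\sigma},\overline{\sigma}) = \frac{2}{\overline{\sigma}+\underline{\sigma}} \int_{-y}^{\infty} \left\{ \phi(z/\overline{\sigma})\,\mathbf{1}(z\ge 0) + \phi(z/\underline{\sigma})\,\mathbf{1}(z<0)\right\} dz .$$
   Context: Here $(t,x)\in[0,\infty)\times\mathbb{R}$, and the formula for $u$ is read for $t>0$. $\phi$ is the density of the standard normal distribution, $\mathbf{1}(\cdot)$ is the indicator function, $u_t=\partial u/\partial t$, $u_{xx}=\partial^2u/\partial x^2$, and the superscripts $+$ and $-$ denote positive and negative parts, $a^+=\max(a,0)$ and $a^-=\max(-a,0)$. The nonlinear equation $u_t = \frac12(\overline{\sigma}^2 (u_{xx})^+ - \underline{\sigma}^2 (u_{xx})^-)$ is called the G-heat equation; solutions of its Cauchy problem are understood in the viscosity sense. When $\underline{\sigma}=0$, $\phi(z/\underline{\sigma})$ for $z<0$ is read as $\phi(-\infty)=0$. *)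

theory Defs
  imports "HOL-Probability.Probability"
begin

text \<open>Space-time points are pairs \<open>(t, x)\<close>; the parabolic domain is the open half plane.\<close>

definition parabolic_domain :: "(real \<times> real) set" where
  "parabolic_domain = {0<..} \<times> UNIV"

text \<open>\<open>\<phi>\<close> is of class \<open>C\<^sup>1\<^sup>,\<^sup>2\<close> (once in time, twice in space) on the open set \<open>N\<close>, with
  derivatives \<open>\<phi>t = \<partial>\<phi>/\<partial>t\<close>, \<open>\<phi>x = \<partial>\<phi>/\<partial>x\<close>, \<open>\<phi>xx = \<partial>\<^sup>2\<phi>/\<partial>x\<^sup>2\<close>.\<close>

definition C12_on ::
  "(real \<times> real) set \<Rightarrow> (real \<times> real \<Rightarrow> real) \<Rightarrow> (real \<times> real \<Rightarrow> real)
    \<Rightarrow> (real \<times> real \<Rightarrow> real) \<Rightarrow> (real \<times> real \<Rightarrow> real) \<Rightarrow> bool" where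
  "C12_on N \<phi> \<phi>t \<phi>x \<phi>xx \<longleftrightarrow>
     (\<forall>(t, x) \<in> N.
        ((\<lambda>s. \<phi> (s, x)) has_real_derivative \<phi>t (t, x)) (at t) \<and>
        ((\<lambda>y. \<phi> (t, y)) has_real_derivative \<phi>x (t, x)) (at x) \<and>
        ((\<lambda>y. \<phi>x (t, y)) has_real_derivative \<phi>xx (t, x)) (at x)) \<and>
     continuous_on N \<phi> \<and> continuous_on N \<phi>t \<and> continuous_on N \<phi>x \<and> continuous_on N \<phi>xx"

text \<open>Viscosity sub- and supersolutions of \<open>u\<^sub>t = F (u\<^sub>x\<^sub>x)\<close> for \<open>t > 0\<close>, in the usual formulation
  with test functions that are \<open>C\<^sup>1\<^sup>,\<^sup>2\<close> near the point \<open>p\<close> at which \<open>u - \<phi>\<close> has a local maximum,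
  respectively minimum. The semicontinuity usually included in these two notions is subsumed by
  the continuity required of a viscosity solution.\<close>

definition viscosity_subsolution :: "(real \<Rightarrow> real) \<Rightarrow> (real \<times> real \<Rightarrow> real) \<Rightarrow> bool" where
  "viscosity_subsolution F u \<longleftrightarrow>
     (\<forall>N p \<phi> \<phi>t \<phi>x \<phi>xx.
        open N \<and> N \<subseteq> parabolic_domain \<and> p \<in> N \<and> C12_on N \<phi> \<phi>t \<phi>x \<phi>xx \<and>
        (\<forall>q\<in>N. u q - \<phi> q \<le> u p - \<phi> p) \<longrightarrow> \<phi>t p \<le> F (\<phi>xx p))"

definition viscosity_supersolution :: "(real \<Rightarrow> real) \<Rightarrow> (real \<times> real \<Rightarrow> real) \<Rightarrow> bool" where
  "viscosity_supersolution F u \<longleftrightarrow>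
     (\<forall>N p \<phi> \<phi>t \<phi>x \<phi>xx.
        open N \<and> N \<subseteq> parabolic_domain \<and> p \<in> N \<and> C12_on N \<phi> \<phi>t \<phi>x \<phi>xx \<and>
        (\<forall>q\<in>N. u q - \<phi> q \<ge> u p - \<phi> p) \<longrightarrow> \<phi>t p \<ge> F (\<phi>xx p))"

definition viscosity_solution :: "(real \<Rightarrow> real) \<Rightarrow> (real \<times> real \<Rightarrow> real) \<Rightarrow> bool" where
  "viscosity_solution F u \<longleftrightarrow>
     continuous_on parabolic_domain u \<and> viscosity_subsolution F u \<and> viscosity_supersolution F u"

text \<open>Attainment of a possibly discontinuous initial datum \<open>g\<close>: besides \<open>u (0, x) = g x\<close>, the
  limits of \<open>u\<close> as \<open>t \<rightarrow> 0+\<close> lie between the lower and the upper semicontinuous envelopes of \<open>g\<close>.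
  The filter \<open>nhds x\<close> contains \<open>x\<close> itself, so the right-hand sides are exactly these envelopes.
  Where \<open>g\<close> is continuous, this says that \<open>u\<close> is continuous at \<open>(0, x)\<close>
  relative to the closed half plane; at a jump of \<open>g\<close> such continuity is impossible.\<close>

definition attains_initial_value :: "(real \<Rightarrow> real) \<Rightarrow> (real \<times> real \<Rightarrow> real) \<Rightarrow> bool" where
  "attains_initial_value g u \<longleftrightarrow>
     (\<forall>x. u (0, x) = g x \<and>
        Limsup (at (0, x) within parabolic_domain) (\<lambda>p. ereal (u p))
          \<le> Limsup (nhds x) (\<lambda>y. ereal (g y)) \<and>
        Liminf (at (0, x) within parabolic_domain) (\<lambda>p. ereal (u p))
          \<ge> Liminf (nhds x) (\<lambda>y. ereal (g y)))"

definition viscosity_solution_Cauchy ::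
  "(real \<Rightarrow> real) \<Rightarrow> (real \<Rightarrow> real) \<Rightarrow> (real \<times> real \<Rightarrow> real) \<Rightarrow> bool" where
  "viscosity_solution_Cauchy F g u \<longleftrightarrow> viscosity_solution F u \<and> attains_initial_value g u"

text \<open>Polynomial growth in space, locally uniformly in time: the usual class in which solutions of
  the Cauchy problem on the whole line are unique.\<close>

definition polynomial_growth :: "(real \<times> real \<Rightarrow> real) \<Rightarrow> bool" where
  "polynomial_growth u \<longleftrightarrow>
     (\<forall>T>0. \<exists>C (k::nat). \<forall>t\<in>{0..T}. \<forall>x. \<bar>u (t, x)\<bar> \<le> C * (1 + \<bar>x\<bar> ^ k))"

definition G_heat_operator :: "real \<Rightarrow> real \<Rightarrow> real \<Rightarrow> real" where
  "G_heat_operator \<sigma>\<^sub>l \<sigma>\<^sub>u a = 1/2 * (\<sigma>\<^sub>u\<^sup>2 * max a 0 - \<sigma>\<^sub>l\<^sup>2 * max (- a) 0)"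

text \<open>For \<open>\<sigma>\<^sub>l = 0\<close> and \<open>z < 0\<close> the density at \<open>z / \<sigma>\<^sub>l\<close> is read as its value \<open>0\<close> at \<open>-\<infinity>\<close>; the
  case distinction is needed because \<open>z / 0 = 0\<close> in HOL.\<close>

definition G_heat_profile :: "real \<Rightarrow> real \<Rightarrow> real \<Rightarrow> real" where
  "G_heat_profile \<sigma>\<^sub>l \<sigma>\<^sub>u y =
     2 / (\<sigma>\<^sub>u + \<sigma>\<^sub>l) *
     (LINT z:{-y..}|lborel.
        std_normal_density (z / \<sigma>\<^sub>u) * indicator {0..} z +
        (if \<sigma>\<^sub>l = 0 then 0 else std_normal_density (z / \<sigma>\<^sub>l)) * indicator {..<0} z)"

definition G_heat_step_function :: "real \<Rightarrow> real \<Rightarrow> real \<Rightarrow> real \<times> real \<Rightarrow> real" where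
  "G_heat_step_function \<sigma>\<^sub>l \<sigma>\<^sub>u c = (\<lambda>(t, x).
     if t > 0 then G_heat_profile \<sigma>\<^sub>l \<sigma>\<^sub>u ((x - c) / sqrt t) else indicator {c<..} x)"

end

theory Submission imports Defs begin

text \<open>For \<open>\<sigma>\<^sub>l > 0\<close> the profile is \<open>C\<^sup>2\<close>, convex on the left and concave on the right of the origin, and
  the self-similar function solves the equation classically. For \<open>\<sigma>\<^sub>l = 0\<close> it is
  \<open>min 1 (2 * u)\<close>, where \<open>u\<close> is the solution with both volatilities equal to \<open>\<sigma>\<^sub>u\<close>; it solves
  the equation in the viscosity sense despite its concave kink along \<open>x = c\<close>.

  For uniqueness, a solution \<open>v\<close> is squeezed between smooth sub- and supersolutions whose jump is
  shifted by \<open>\<epsilon>\<close>, and \<open>\<epsilon>\<close> tends to \<open>0\<close>. When \<open>\<sigma>\<^sub>l = 0\<close>, the upper function is \<open>2 * u\<close>, which is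
  a supersolution wherever it is below the a priori bound \<open>v \<le> 1\<close>, and the lower functions are the
  step solutions with lower volatility \<open>s > 0\<close>, where \<open>s\<close> tends to \<open>0\<close>.\<close>

section \<open>The profile\<close>

text \<open>The half-line integral of \<open>exp (- z\<^sup>2)\<close> from
  \<open>gaussian_moment_0\<close> is rescaled by the factor \<open>1 / (sqrt 2 * s)\<close>; the
  same factor with a minus sign gives the left half line. The value is \<open>s / 2\<close> because
  \<open>std_normal_density (z / s)\<close> lacks the normalisation \<open>1 / s\<close>.\<close>

lemma has_bochner_integral_half_normal:
  fixes s :: real
  assumes "s > 0"
  shows "has_bochner_integral lborel (\<lambda>z. indicator {0..} z * std_normal_density (z / s)) (s / 2)"
    and "has_bochner_integral lborel (\<lambda>z. indicator {..0} z * std_normal_density (z / s)) (s / 2)"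
proof -
  have ind: "indicator {0..} (z / (sqrt 2 * s)) = (indicator {0..} z :: real)"
    "indicator {0..} (- (z / (sqrt 2 * s))) = (indicator {..0} z :: real)" for z
    using assms by (auto simp: indicator_def zero_le_divide_iff divide_le_0_iff mult_le_0_iff zero_le_mult_iff)
  have e: "inverse (sqrt (2 * pi)) * exp (- (z / (sqrt 2 * s))\<^sup>2) = std_normal_density (z / s)" for z
    unfolding std_normal_density_def by (simp add: power_divide power_mult_distrib field_simps)
  have val: "inverse (sqrt (2 * pi)) * ((sqrt pi / 2) * (sqrt 2 * s)) = s / 2"
    by (simp add: real_sqrt_mult field_simps)
  have gen: "has_bochner_integral lborel
      (\<lambda>z. inverse (sqrt (2 * pi)) * (indicator {0..} (0 + c * z) *\<^sub>R exp (- (0 + c * z)\<^sup>2))) (s / 2)"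
    if c: "c = 1 / (sqrt 2 * s) \<or> c = - (1 / (sqrt 2 * s))" for c :: real
  proof -
    have "c \<noteq> 0" "\<bar>c\<bar> = 1 / (sqrt 2 * s)" using c assms by (auto simp: abs_mult)
    then have "has_bochner_integral lborel
        (\<lambda>z. indicator {0..} (0 + c * z) *\<^sub>R exp (- (0 + c * z)\<^sup>2)) ((sqrt pi / 2) * (sqrt 2 * s))"
      using lborel_has_bochner_integral_real_affine_iff[of c "\<lambda>z. indicator {0..} z *\<^sub>R exp (- z\<^sup>2)"
        "sqrt pi / 2" 0] gaussian_moment_0 by (simp add: field_simps)
    from has_bochner_integral_mult_right[OF this, of "inverse (sqrt (2 * pi))"] show ?thesis
      unfolding val by simp
  qed
  show "has_bochner_integral lborel (\<lambda>z. indicator {0..} z * std_normal_density (z / s)) (s / 2)"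
    using gen[of "1 / (sqrt 2 * s)"] ind(1) e by (simp add: mult.left_commute)
  show "has_bochner_integral lborel (\<lambda>z. indicator {..0} z * std_normal_density (z / s)) (s / 2)"
    using gen[of "- (1 / (sqrt 2 * s))"] ind(2) e by (simp add: mult.left_commute)
qed

text \<open>The integrand of the profile, reflected at the origin so that it becomes the derivative of
  the profile up to normalisation.\<close>

definition profile_density :: "real \<Rightarrow> real \<Rightarrow> real \<Rightarrow> real" where
  "profile_density l u y =
     exp (- ((max (- y) 0)\<^sup>2 / u\<^sup>2 + (max y 0)\<^sup>2 / l\<^sup>2) / 2) / sqrt (2 * pi)"

lemma profile_density_pos: "0 < profile_density l u y"
  by (simp add: profile_density_def)

text \<open>The squared positive parts in \<open>profile_density\<close> glue two half-line
  Gaussians into one formula that can be differentiated at the origin. After the reflection,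
  \<open>u\<close> governs the left half line and \<open>l\<close> the right one.\<close>

lemma profile_density_eq:
  "profile_density l u y = std_normal_density (y / u) * indicator {..0} y
     + std_normal_density (y / l) * indicator {0<..} y"
  unfolding profile_density_def std_normal_density_def
  by (auto simp: indicator_def max_def power_divide)

text \<open>Squaring removes the kink: at the origin the difference quotient is
  \<open>max h 0\<close> itself, which tends to \<open>0\<close>.\<close>

lemma has_real_derivative_max_0_squared:
  "((\<lambda>y::real. (max y 0)\<^sup>2) has_real_derivative 2 * max x 0) (at x)"
proof (cases x "0 :: real" rule: linorder_cases)
  case less
  then have "((\<lambda>y::real. 0) has_real_derivative 2 * max x 0) (at x)" by simp
  then show ?thesis
    by (rule DERIV_cong_ev[THEN iffD1, rotated -1])
      (use less in \<open>auto intro!: eventually_mono[OF eventually_nhds_in_open[of "{..<0}" x]]\<close>)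
next
  case greater
  then have "((\<lambda>y::real. y\<^sup>2) has_real_derivative 2 * max x 0) (at x)"
    by (auto intro!: derivative_eq_intros)
  then show ?thesis
    by (rule DERIV_cong_ev[THEN iffD1, rotated -1])
      (use greater in \<open>auto intro!: eventually_mono[OF eventually_nhds_in_open[of "{0<..}" x]]\<close>)
next
  case equal
  have "((\<lambda>h::real. max h 0) \<longlongrightarrow> max 0 0) (at 0)"
    by (intro tendsto_intros)
  moreover have "(max h 0)\<^sup>2 / h = max h 0" for h :: real
    by (auto simp: max_def power2_eq_square)
  ultimately show ?thesis
    unfolding equal DERIV_def by simp
qed

text \<open>The bracket is nonnegative on the left of the origin and nonpositive on the right. This
  sign change makes the profile convex, then concave, and selects the volatility in the G-heat
  operator.\<close>

lemma has_real_derivative_profile_density: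
  "(profile_density l u has_real_derivative
     profile_density l u y * (max (- y) 0 / u\<^sup>2 - max y 0 / l\<^sup>2)) (at y)"
proof -
  have m: "((\<lambda>y::real. (max (- y) 0)\<^sup>2) has_real_derivative - (2 * max (- y) 0)) (at y)"
    using DERIV_chain2[OF has_real_derivative_max_0_squared[of "- y"] DERIV_minus[OF DERIV_ident]]
    by simp
  have "((\<lambda>y. - ((max (- y) 0)\<^sup>2 / u\<^sup>2 + (max y 0)\<^sup>2 / l\<^sup>2) / 2) has_real_derivative
      - (- (2 * max (- y) 0) / u\<^sup>2 + 2 * max y 0 / l\<^sup>2) / 2) (at y)"
    by (intro DERIV_cdivide DERIV_minus DERIV_add m has_real_derivative_max_0_squared)
  from DERIV_cdivide[OF DERIV_chain2[OF DERIV_exp this], of "sqrt (2 * pi)"] show ?thesis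
    unfolding profile_density_def[abs_def]
    by (rule DERIV_cong) (simp add: add_divide_distrib diff_divide_distrib algebra_simps)
qed

lemma continuous_on_profile_density [continuous_intros]: "continuous_on S (profile_density l u)"
  by (rule DERIV_continuous_on[OF has_field_derivative_at_within[OF has_real_derivative_profile_density]])

lemma integrable_profile_density:
  assumes "l > 0" "u > 0"
  shows "integrable lborel (profile_density l u)"
proof (rule Bochner_Integration.integrable_bound)
  have *: "integrable lborel (\<lambda>y. std_normal_density (y / s))" if "s > 0" for s
  proof -
    have "std_normal_density (y / s) = s * normal_density 0 s y" for y
      using that unfolding normal_density_def
      by (simp add: real_sqrt_mult power_divide field_simps)
    then show ?thesis using integrable_normal_density[OF that] by simp
  qed
  show "integrable lborel (\<lambda>y. std_normal_density (y / u) + std_normal_density (y / l))"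
    using assms * by simp
  show "profile_density l u \<in> borel_measurable lborel"
    using borel_measurable_continuous_onI[OF continuous_on_profile_density] by simp
  show "AE y in lborel. norm (profile_density l u y)
      \<le> norm (std_normal_density (y / u) + std_normal_density (y / l))"
    by (rule AE_I2) (auto simp: profile_density_eq indicator_def)
qed

lemma integral_profile_density_atMost_0:
  assumes "u > 0"
  shows "(LINT z|lborel. indicator {..0} z * profile_density l u z) = u / 2"
proof -
  have "indicator {..0} z * profile_density l u z = indicator {..0} z * std_normal_density (z / u)" for z
    by (auto simp: profile_density_eq indicator_def)
  then have "(\<lambda>z. indicator {..0} z * profile_density l u z)
      = (\<lambda>z. indicator {..0} z * std_normal_density (z / u))" by (rule ext)
  then show ?thesis
    using has_bochner_integral_half_normal(2)[OF assms] by (simp only: has_bochner_integral_iff)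
qed

text \<open>The two half-line pieces overlap only in the null set \<open>{0}\<close>, so their
  masses add up; the sum explains the normalising factor \<open>2 / (u + l)\<close> of the
  profile.\<close>

lemma integral_profile_density:
  assumes "l > 0" "u > 0"
  shows "(LINT z|lborel. profile_density l u z) = (u + l) / 2"
proof -
  have "(LINT z|lborel. profile_density l u z) = (LINT z|lborel. indicator {..0} z * std_normal_density (z / u)
     + indicator {0..} z * std_normal_density (z / l))"
  proof (rule integral_cong_AE)
    show "AE z in lborel. profile_density l u z =
        indicator {..0} z * std_normal_density (z / u) + indicator {0..} z * std_normal_density (z / l)"
      using AE_lborel_singleton[of "0::real"]
      by eventually_elim (auto simp: profile_density_eq indicator_def)
  qed (use borel_measurable_continuous_onI[OF continuous_on_profile_density] in auto)
  also have "\<dots> = u / 2 + l / 2"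
    using has_bochner_integral_half_normal[OF assms(1)] has_bochner_integral_half_normal[OF assms(2)]
    by (simp add: has_bochner_integral_iff)
  finally show ?thesis by (simp add: add_divide_distrib)
qed

text \<open>The substitution of \<open>- z\<close> for \<open>z\<close> exhibits the profile as a
  distribution function, from which its monotonicity, bounds, limits and derivative are read
  off.\<close>

lemma profile_eq_integral_density:
  assumes "l > 0" "u > 0"
  shows "G_heat_profile l u y = 2 / (u + l) * (LINT z|lborel. indicator {..y} z * profile_density l u z)"
proof -
  have "(LINT z:{-y..}|lborel. std_normal_density (z / u) * indicator {0..} z +
        std_normal_density (z / l) * indicator {..<0} z)
    = (LINT z|lborel. indicator {-y..} z * (std_normal_density (z / u) * indicator {0..} z +
        std_normal_density (z / l) * indicator {..<0} z))"
    by (simp add: set_lebesgue_integral_def)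
  also have "\<dots> = (LINT z|lborel. indicator {-y..} (0 + (-1) * z) * (std_normal_density ((0 + (-1) * z) / u)
      * indicator {0..} (0 + (-1) * z) + std_normal_density ((0 + (-1) * z) / l) * indicator {..<0} (0 + (-1) * z)))"
    by (subst lborel_integral_real_affine[of "-1" _ 0]) simp_all
  also have "\<dots> = (LINT z|lborel. indicator {..y} z * profile_density l u z)"
    by (intro Bochner_Integration.integral_cong)
      (auto simp: profile_density_eq indicator_def std_normal_density_def)
  finally show ?thesis using assms by (simp add: G_heat_profile_def)
qed

section \<open>Monotonicity, bounds, limits and derivative of the profile\<close>

lemma integrable_indicator_profile_density:
  assumes "l > 0" "u > 0" "A \<in> sets borel"
  shows "integrable lborel (\<lambda>z. indicator A z * profile_density l u z)"
  using integrable_mult_indicator[OF _ integrable_profile_density[OF assms(1,2)], of A] assms(3) by simp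

lemma mono_profile:
  assumes "l > 0" "u > 0" "x \<le> y"
  shows "G_heat_profile l u x \<le> G_heat_profile l u y"
  unfolding profile_eq_integral_density[OF assms(1,2)] using assms
  by (intro mult_left_mono integral_mono integrable_indicator_profile_density)
    (auto simp: indicator_def less_imp_le[OF profile_density_pos])

lemma profile_nonneg:
  assumes "l > 0" "u > 0"
  shows "0 \<le> G_heat_profile l u y"
  unfolding profile_eq_integral_density[OF assms] using assms
  by (intro mult_nonneg_nonneg Bochner_Integration.integral_nonneg)
    (auto simp: indicator_def less_imp_le[OF profile_density_pos])

lemma profile_le_1:
  assumes "l > 0" "u > 0"
  shows "G_heat_profile l u y \<le> 1"
proof -
  have "(LINT z|lborel. indicator {..y} z * profile_density l u z) \<le> (LINT z|lborel. profile_density l u z)"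
    using assms
    by (intro integral_mono integrable_indicator_profile_density integrable_profile_density)
      (auto simp: indicator_def less_imp_le[OF profile_density_pos])
  then show ?thesis
    unfolding profile_eq_integral_density[OF assms] using assms
    by (simp add: integral_profile_density field_simps)
qed

lemma profile_0:
  assumes "l > 0" "u > 0"
  shows "G_heat_profile l u 0 = u / (u + l)"
  using assms by (simp add: profile_eq_integral_density integral_profile_density_atMost_0 field_simps)

lemma profile_at_top:
  assumes "l > 0" "u > 0"
  shows "(G_heat_profile l u \<longlongrightarrow> 1) at_top"
proof -
  have "((\<lambda>y. 2 / (u + l) * (LINT z|lborel. indicator {..y} z *\<^sub>R profile_density l u z))
      \<longlongrightarrow> 2 / (u + l) * (LINT z|lborel. profile_density l u z)) at_top"
    by (intro tendsto_intros tendsto_integral_at_top integrable_profile_density assms) simp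
  moreover have "2 / (u + l) * (LINT z|lborel. profile_density l u z) = 1"
    using assms by (simp add: integral_profile_density)
  moreover have "G_heat_profile l u = (\<lambda>y. 2 / (u + l) * (LINT z|lborel. indicator {..y} z *\<^sub>R profile_density l u z))"
    by (rule ext) (simp add: profile_eq_integral_density[OF assms])
  ultimately show ?thesis by simp
qed

lemma profile_at_bot:
  assumes "l > 0" "u > 0"
  shows "(G_heat_profile l u \<longlongrightarrow> 0) at_bot"
proof -
  \<comment> \<open>The profile is one minus the normalised mass of \<open>{y..}\<close>. Reflection
    turns this mass into that of \<open>{..- y}\<close> under \<open>?k\<close>, which tends to the
    total mass as \<open>y\<close> tends to minus infinity.\<close>
  let ?k = "\<lambda>z. profile_density l u (- z)"
  have int: "integrable lborel ?k"
    using lborel_integrable_real_affine[OF integrable_profile_density[OF assms], of "-1" 0] by simp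
  have tot: "(LINT z|lborel. ?k z) = (u + l) / 2"
    using lborel_integral_real_affine[of "-1" "profile_density l u" 0] assms
    by (simp add: integral_profile_density)
  have "((\<lambda>y. (LINT z|lborel. indicator {..y} z *\<^sub>R ?k z)) \<longlongrightarrow> (u + l) / 2) at_top"
    unfolding tot[symmetric] by (intro tendsto_integral_at_top int) simp
  then have lim: "((\<lambda>y. 1 - 2 / (u + l) * (LINT z|lborel. indicator {..- y} z *\<^sub>R ?k z))
      \<longlongrightarrow> 1 - 2 / (u + l) * ((u + l) / 2)) at_bot"
    by (intro tendsto_intros)
      (rule filterlim_compose[of _ _ at_top], assumption, rule filterlim_uminus_at_top_at_bot)
  have "G_heat_profile l u y = 1 - 2 / (u + l) * (LINT z|lborel. indicator {..- y} z *\<^sub>R ?k z)" for y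
  proof -
    have r: "(LINT z|lborel. indicator {..- y} z *\<^sub>R ?k z)
        = (LINT z|lborel. indicator {y..} z * profile_density l u z)"
      by (subst lborel_integral_real_affine[of "-1" _ 0])
        (auto intro!: Bochner_Integration.integral_cong simp: indicator_def)
    have "(u + l) / 2 = (LINT z|lborel. profile_density l u z)"
      using assms by (simp add: integral_profile_density)
    also have "\<dots> = (LINT z|lborel. indicator {..y} z * profile_density l u z
        + indicator {y..} z * profile_density l u z)"
    proof (rule integral_cong_AE)
      show "AE z in lborel. profile_density l u z =
          indicator {..y} z * profile_density l u z + indicator {y..} z * profile_density l u z"
        using AE_lborel_singleton[of y]
        by eventually_elim (auto simp: indicator_def)
    qed (use borel_measurable_continuous_onI[OF continuous_on_profile_density] in auto)
    also have "\<dots> = (LINT z|lborel. indicator {..y} z * profile_density l u z)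
        + (LINT z|lborel. indicator {y..} z * profile_density l u z)"
      using assms by (intro Bochner_Integration.integral_add integrable_indicator_profile_density) auto
    finally show ?thesis
      unfolding r profile_eq_integral_density[OF assms] using assms by (simp add: field_simps)
  qed
  then have "G_heat_profile l u = (\<lambda>y. 1 - 2 / (u + l) * (LINT z|lborel. indicator {..- y} z *\<^sub>R ?k z))"
    by (rule ext)
  moreover have "1 - 2 / (u + l) * ((u + l) / 2) = 0" using assms by simp
  ultimately show ?thesis using lim by (simp only:)
qed

lemma has_real_derivative_profile:
  assumes "l > 0" "u > 0"
  shows "(G_heat_profile l u has_real_derivative 2 / (u + l) * profile_density l u y) (at y)"
proof -
  let ?I = "\<lambda>x. LINT z|lborel. indicator {..x} z * profile_density l u z"
  \<comment> \<open>Cutting at \<open>a\<close> leaves an integral of a continuous function over a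
    compact interval, to which the fundamental theorem of calculus applies. As \<open>y\<close> is
    interior to \<open>{a..b}\<close>, the derivative within the interval is a full
    derivative.\<close>
  define a b where "a = y - 1" and "b = y + 1"
  have split: "?I x = ?I a + integral {a..x} (profile_density l u)" if "a \<le> x" for x
  proof -
    have int: "set_integrable lborel {a..x} (profile_density l u)"
      unfolding set_integrable_def
      using integrable_indicator_profile_density[OF assms, of "{a..x}"] by simp
    have "?I x = (LINT z|lborel. indicator {..a} z * profile_density l u z
        + indicator {a..x} z * profile_density l u z)"
    proof (rule integral_cong_AE)
      show "AE z in lborel. indicator {..x} z * profile_density l u z =
          indicator {..a} z * profile_density l u z + indicator {a..x} z * profile_density l u z"
        using AE_lborel_singleton[of a] by eventually_elim (use that in \<open>auto simp: indicator_def\<close>)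
    qed (use borel_measurable_continuous_onI[OF continuous_on_profile_density] in auto)
    also have "\<dots> = ?I a + (LINT z:{a..x}|lborel. profile_density l u z)"
      unfolding set_lebesgue_integral_def using assms
      by (subst Bochner_Integration.integral_add) (auto intro!: integrable_indicator_profile_density)
    finally show ?thesis using set_borel_integral_eq_integral(2)[OF int] by simp
  qed
  have "((\<lambda>x. integral {a..x} (profile_density l u)) has_real_derivative profile_density l u y)
      (at y within {a..b})"
    by (rule integral_has_real_derivative) (auto simp: a_def b_def intro: continuous_intros)
  then have "((\<lambda>x. integral {a..x} (profile_density l u)) has_real_derivative profile_density l u y) (at y)"
    by (simp add: a_def b_def at_within_Icc_at)
  then have "((\<lambda>x. 2 / (u + l) * (?I a + integral {a..x} (profile_density l u)))
      has_real_derivative 2 / (u + l) * profile_density l u y) (at y)"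
    using DERIV_cmult[OF DERIV_add[OF DERIV_const[of "?I a"]], of "\<lambda>x. integral {a..x} (profile_density l u)"
      "profile_density l u y" y UNIV "2 / (u + l)"] by simp
  then show ?thesis
  proof (rule has_field_derivative_transform_within_open)
    show "open {a<..}" "y \<in> {a<..}" by (auto simp: a_def)
    show "2 / (u + l) * (?I a + integral {a..x} (profile_density l u)) = G_heat_profile l u x"
      if "x \<in> {a<..}" for x
      using split[of x] that by (simp add: profile_eq_integral_density[OF assms])
  qed
qed

text \<open>For \<open>y \<le> 0\<close> the integral sees only \<open>z \<ge> 0\<close>, so
  profiles with different lower volatilities differ only by their normalising factors. For
  \<open>y \<ge> 0\<close> the profile with lower volatility \<open>0\<close> is constantly
  \<open>1\<close>, and any other is at least its value \<open>u / (u + s)\<close> at the origin.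
  The second claim gives a lower bound whose limit as \<open>s\<close> tends to \<open>0\<close> is
  immediate.\<close>

lemma profile_sigma_0:
  assumes "u > 0"
  shows "G_heat_profile 0 u y = min 1 (2 * G_heat_profile u u y)"
    and "0 < s \<Longrightarrow> u / (u + s) * G_heat_profile 0 u y \<le> G_heat_profile s u y"
proof -
  let ?J = "\<lambda>y. LINT z:{-y..}|lborel. std_normal_density (z / u) * indicator {0..} z"
  have neg: "G_heat_profile 0 u y = 2 / u * ?J y" for y
    by (simp add: G_heat_profile_def)
  have le: "G_heat_profile s u y = 2 / (u + s) * ?J y" if "s > 0" "y \<le> 0" for s y
    unfolding G_heat_profile_def set_lebesgue_integral_def using that
    by (auto intro!: Bochner_Integration.integral_cong simp: indicator_def)
  have ge: "?J y = ?J 0" if "0 \<le> y" for y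
    unfolding set_lebesgue_integral_def using that
    by (intro Bochner_Integration.integral_cong) (auto simp: indicator_def)
  have J0: "?J 0 = u / 2"
    using le[OF assms, of 0] profile_0[OF assms assms] assms by simp
  have one: "G_heat_profile 0 u y = 1" if "0 \<le> y" for y
    using neg[of y] ge[OF that] J0 assms by simp
  have half: "1 / 2 = G_heat_profile u u 0"
    using profile_0[OF assms assms] assms by simp
  show "G_heat_profile 0 u y = min 1 (2 * G_heat_profile u u y)"
  proof (cases "y \<le> 0")
    case True
    then have "G_heat_profile 0 u y = 2 * G_heat_profile u u y"
      using neg[of y] le[OF assms True] assms by simp
    moreover have "G_heat_profile u u y \<le> 1 / 2"
      unfolding half by (rule mono_profile[OF assms assms True])
    ultimately show ?thesis by simp
  next
    case False
    then have "1 / 2 \<le> G_heat_profile u u y"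
      unfolding half by (intro mono_profile assms) simp
    then show ?thesis using one[of y] False by simp
  qed
  show "u / (u + s) * G_heat_profile 0 u y \<le> G_heat_profile s u y" if "0 < s"
  proof (cases "y \<le> 0")
    case True
    then show ?thesis using neg[of y] le[OF that True] assms that by simp
  next
    case False
    then show ?thesis
      using one[of y] profile_0[OF that assms] mono_profile[OF that assms, of 0 y] by simp
  qed
qed

section \<open>Comparison with smooth supersolutions\<close>

text \<open>If \<open>g''\<close> were positive, \<open>g'\<close> would be positive just to the
  right of its zero \<open>x\<close>, and the mean value theorem would produce a value of
  \<open>g\<close> above \<open>g x\<close>.\<close>

lemma local_max_second_derivative_nonpos:
  fixes g g' :: "real \<Rightarrow> real"
  assumes "e > 0" and g: "\<And>y. \<bar>x - y\<bar> < e \<Longrightarrow> (g has_real_derivative g' y) (at y)"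
    and g': "(g' has_real_derivative g'') (at x)"
    and le: "\<And>y. \<bar>x - y\<bar> < e \<Longrightarrow> g y \<le> g x"
  shows "g'' \<le> 0"
proof (rule ccontr)
  assume "\<not> g'' \<le> 0"
  then obtain d where d: "d > 0" "\<And>h. 0 < h \<Longrightarrow> h < d \<Longrightarrow> g' x < g' (x + h)"
    using DERIV_pos_inc_right[OF g'] by auto
  have "g' x = 0"
    using DERIV_local_max[OF g[of x] \<open>e > 0\<close>] le \<open>e > 0\<close> by auto
  define h where "h = min d e / 2"
  have h: "0 < h" "h < d" "h < e" using d(1) \<open>e > 0\<close> by (auto simp: h_def min_def)
  obtain z where z: "x < z" "z < x + h" "g (x + h) - g x = (x + h - x) * g' z"
    using MVT2[of x "x + h" g g'] g h by auto
  have "0 < g' z" using d(2)[of "z - x"] z h \<open>g' x = 0\<close> by auto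
  then have "g x < g (x + h)" using z h by (simp add: algebra_simps)
  then show False using le[of "x + h"] h by auto
qed

section \<open>Calculus of \<open>C12_on\<close> functions and conditions at touching points\<close>

lemma C12_on_subset: "C12_on N f ft fx fxx \<Longrightarrow> M \<subseteq> N \<Longrightarrow> C12_on M f ft fx fxx"
  unfolding C12_on_def by (auto intro: continuous_on_subset)

lemma C12_on_add:
  assumes "C12_on N f ft fx fxx" "C12_on N g gt gx gxx"
  shows "C12_on N (\<lambda>p. f p + g p) (\<lambda>p. ft p + gt p) (\<lambda>p. fx p + gx p) (\<lambda>p. fxx p + gxx p)"
  using assms unfolding C12_on_def by (fastforce intro!: DERIV_add continuous_intros)

lemma C12_on_cmult:
  assumes "C12_on N f ft fx fxx"
  shows "C12_on N (\<lambda>p. a * f p) (\<lambda>p. a * ft p) (\<lambda>p. a * fx p) (\<lambda>p. a * fxx p)"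
  using assms unfolding C12_on_def by (fastforce intro!: DERIV_cmult continuous_intros)

lemma C12_on_const: "C12_on N (\<lambda>p. a) (\<lambda>p. 0) (\<lambda>p. 0) (\<lambda>p. 0)"
  unfolding C12_on_def by auto

lemma C12_on_diff:
  assumes "C12_on N f ft fx fxx" "C12_on N g gt gx gxx"
  shows "C12_on N (\<lambda>p. f p - g p) (\<lambda>p. ft p - gt p) (\<lambda>p. fx p - gx p) (\<lambda>p. fxx p - gxx p)"
  using C12_on_add[OF assms(1) C12_on_cmult[OF assms(2), of "-1"]] by simp

lemma open_slices:
  fixes N :: "(real \<times> real) set"
  assumes "open N"
  shows "open {s. (s, x) \<in> N}" "open {y. (t, y) \<in> N}"
proof -
  have "continuous_on UNIV (\<lambda>s::real. (s, x))" "continuous_on UNIV (\<lambda>y::real. (t, y))"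
    by (intro continuous_intros)+
  from this[THEN open_vimage[OF assms]] show "open {s. (s, x) \<in> N}" "open {y. (t, y) \<in> N}"
    by (simp_all add: vimage_def)
qed

text \<open>A maximum along the time line through the point suffices, with no control in space; this
  form is needed on and to the right of the kink when the lower volatility is
  \<open>0\<close>.\<close>

lemma time_derivative_at_max:
  fixes N :: "(real \<times> real) set"
  assumes "open N" "(t, x) \<in> N" "((\<lambda>s. f (s, x)) has_real_derivative d) (at t)"
    and "\<And>s. (s, x) \<in> N \<Longrightarrow> f (s, x) \<le> f (t, x)"
  shows "d = 0"
proof -
  obtain e where "e > 0" "ball t e \<subseteq> {s. (s, x) \<in> N}"
    using open_slices(1)[OF assms(1), of x] assms(2) by (meson mem_Collect_eq openE)
  then show ?thesis
    using DERIV_local_max[OF assms(3), of e] assms(4) by (auto simp: dist_real_def subset_iff)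
qed

lemma C12_on_max:
  assumes "C12_on N f ft fx fxx" "open N" "p \<in> N" and max: "\<And>q. q \<in> N \<Longrightarrow> f q \<le> f p"
  shows "ft p = 0" "fxx p \<le> 0"
proof -
  obtain t x where p: "p = (t, x)" by (cases p)
  have d: "((\<lambda>s. f (s, z)) has_real_derivative ft (s, z)) (at s)"
    "((\<lambda>y. f (s, y)) has_real_derivative fx (s, z)) (at z)"
    "((\<lambda>y. fx (s, y)) has_real_derivative fxx (s, z)) (at z)" if "(s, z) \<in> N" for s z
    using assms(1) that unfolding C12_on_def by auto
  show "ft p = 0"
    using time_derivative_at_max[OF assms(2) _ d(1)] assms(3) max unfolding p by auto
  obtain e where e: "e > 0" "ball x e \<subseteq> {y. (t, y) \<in> N}"
    using open_slices(2)[OF assms(2), of t] assms(3) unfolding p by (meson mem_Collect_eq openE)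
  then show "fxx p \<le> 0"
    using local_max_second_derivative_nonpos[OF e(1), of x "\<lambda>y. f (t, y)" "\<lambda>y. fx (t, y)" "fxx p"]
      d max assms(3) unfolding p by (auto simp: dist_real_def subset_iff)
qed

lemma open_parabolic_domain: "open parabolic_domain"
  unfolding parabolic_domain_def by (intro open_Times) auto

text \<open>Maximum conditions for a difference of smooth functions on the overlap of their domains.
  Either function may be the test function: the subsolution proof uses \<open>\<phi>\<close> in this
  role, the supersolution proof swaps the two.\<close>

lemma C12_on_touching:
  assumes "C12_on M u ut ux uxx" "open M" "p \<in> M" "C12_on N \<phi> \<phi>t \<phi>x \<phi>xx" "open N" "p \<in> N"
    and max: "\<And>q. q \<in> M \<inter> N \<Longrightarrow> u q - \<phi> q \<le> u p - \<phi> p"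
  shows "\<phi>t p = ut p" "uxx p \<le> \<phi>xx p"
proof -
  have "C12_on (M \<inter> N) (\<lambda>p. u p - \<phi> p) (\<lambda>p. ut p - \<phi>t p) (\<lambda>p. ux p - \<phi>x p) (\<lambda>p. uxx p - \<phi>xx p)"
    using assms by (intro C12_on_diff) (auto intro: C12_on_subset)
  from C12_on_max[OF this open_Int[OF \<open>open M\<close> \<open>open N\<close>], of p] max
  show "\<phi>t p = ut p" "uxx p \<le> \<phi>xx p"
    using \<open>p \<in> M\<close> \<open>p \<in> N\<close> by auto
qed

text \<open>Negating the test function exchanges touching from below and from above. The single
  comparison lemma for subsolutions thereby also yields lower bounds.\<close>

lemma viscosity_subsolution_uminus:
  assumes "viscosity_supersolution F v"
  shows "viscosity_subsolution (\<lambda>a. - F (- a)) (\<lambda>p. - v p)"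
  unfolding viscosity_subsolution_def
proof (intro allI impI, elim conjE)
  fix N p \<phi> \<phi>t \<phi>x \<phi>xx
  assume *: "open N" "N \<subseteq> parabolic_domain" "p \<in> N" "C12_on N \<phi> \<phi>t \<phi>x \<phi>xx"
    "\<forall>q\<in>N. - v q - \<phi> q \<le> - v p - \<phi> p"
  have "C12_on N (\<lambda>p. - \<phi> p) (\<lambda>p. - \<phi>t p) (\<lambda>p. - \<phi>x p) (\<lambda>p. - \<phi>xx p)"
    using C12_on_cmult[OF *(4), of "-1"] by simp
  moreover have "\<forall>q\<in>N. v q - - \<phi> q \<ge> v p - - \<phi> p" using *(5) by force
  ultimately have "- \<phi>t p \<ge> F (- \<phi>xx p)"
    using assms[unfolded viscosity_supersolution_def, rule_format,
        of N p "\<lambda>p. - \<phi> p" "\<lambda>p. - \<phi>t p" "\<lambda>p. - \<phi>x p" "\<lambda>p. - \<phi>xx p"] * by blast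
  then show "\<phi>t p \<le> - F (- \<phi>xx p)" by simp
qed

text \<open>The barrier used in the comparison argument: it outgrows the polynomial \<open>1 + \<bar>x\<bar> ^ k\<close> in
  space, blows up at time \<open>T\<close>, and for \<open>K\<close> large is a strict supersolution of \<open>u\<^sub>t = L u\<^sub>x\<^sub>x\<close>.\<close>

definition barrier :: "real \<Rightarrow> nat \<Rightarrow> real \<Rightarrow> real \<times> real \<Rightarrow> real" where
  "barrier K k T = (\<lambda>(t, x). exp (K * t) * (1 + x ^ (2 * k + 2)) + 1 / (T - t))"

lemma C12_on_barrier:
  "C12_on ({0<..<T} \<times> UNIV) (barrier K k T)
     (\<lambda>(t, x). K * exp (K * t) * (1 + x ^ (2 * k + 2)) + 1 / (T - t)\<^sup>2)
     (\<lambda>(t, x). exp (K * t) * (real (2 * k + 2) * x ^ (2 * k + 1)))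
     (\<lambda>(t, x). exp (K * t) * (real (2 * k + 2) * (real (2 * k + 1) * x ^ (2 * k))))"
  unfolding C12_on_def
proof (intro conjI ballI, goal_cases)
  case (1 p)
  show ?case
  proof (cases p)
    case (Pair t x)
    have "((\<lambda>s. exp (K * s) * (1 + x ^ (2 * k + 2)) + 1 / (T - s)) has_real_derivative
        K * exp (K * t) * (1 + x ^ (2 * k + 2)) + 1 / (T - t)\<^sup>2) (at t)"
      using 1 Pair by (auto intro!: derivative_eq_intros simp: power2_eq_square field_simps)
    moreover have "((\<lambda>y. exp (K * t) * (1 + y ^ (2 * k + 2)) + 1 / (T - t)) has_real_derivative
        exp (K * t) * (real (2 * k + 2) * x ^ (2 * k + 1))) (at x)"
      by (rule derivative_eq_intros refl | simp)+
    moreover have "((\<lambda>y. exp (K * t) * (real (2 * k + 2) * y ^ (2 * k + 1))) has_real_derivative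
        exp (K * t) * (real (2 * k + 2) * (real (2 * k + 1) * x ^ (2 * k)))) (at x)"
      by (rule derivative_eq_intros refl | simp)+
    ultimately show ?thesis unfolding Pair barrier_def by simp
  qed
qed (auto simp: barrier_def case_prod_beta intro!: continuous_intros)

lemma barrier_ge:
  assumes "0 \<le> K" "0 < t" "t < T"
  shows "1 + x ^ (2 * k + 2) + 1 / (T - t) \<le> barrier K k T (t, x)"
proof -
  have "0 \<le> x ^ (2 * k + 2)" by (rule zero_le_even_power) simp
  then have "1 * (1 + x ^ (2 * k + 2)) \<le> exp (K * t) * (1 + x ^ (2 * k + 2))"
    using assms by (intro mult_right_mono) auto
  then show ?thesis by (simp add: barrier_def)
qed

text \<open>Since \<open>x ^ (2 * k) \<le> 1 + x ^ (2 * k + 2)\<close>, this \<open>K\<close>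
  absorbs the constants produced by two space derivatives; strictness comes from the time derivative
  of \<open>1 / (T - t)\<close>.\<close>

lemma barrier_strict:
  assumes "0 < t" "t < T" and K: "K = \<bar>L\<bar> * (real (2 * k + 2) * real (2 * k + 1))"
  shows "L * (exp (K * t) * (real (2 * k + 2) * (real (2 * k + 1) * x ^ (2 * k))))
    < K * exp (K * t) * (1 + x ^ (2 * k + 2)) + 1 / (T - t)\<^sup>2"
proof -
  have e: "0 \<le> x ^ (2 * k)" "0 \<le> x ^ (2 * k + 2)" by (rule zero_le_even_power, simp)+
  have "x ^ (2 * k) \<le> 1 + x ^ (2 * k + 2)"
  proof (cases "\<bar>x\<bar> \<le> 1")
    case True
    then have "x ^ (2 * k) \<le> 1" using e(1) power_le_one[of "\<bar>x\<bar>" "2 * k"] by (simp add: power_even_abs)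
    then show ?thesis using e by simp
  next
    case False
    then have "\<bar>x\<bar> ^ (2 * k) \<le> \<bar>x\<bar> ^ (2 * k + 2)" by (intro power_increasing) auto
    then have "x ^ (2 * k) \<le> x ^ (2 * k + 2)" by (simp add: power_even_abs)
    then show ?thesis by simp
  qed
  then have "K * exp (K * t) * x ^ (2 * k) \<le> K * exp (K * t) * (1 + x ^ (2 * k + 2))"
    using K by (intro mult_left_mono) auto
  moreover have "L * (exp (K * t) * (real (2 * k + 2) * (real (2 * k + 1) * x ^ (2 * k))))
      \<le> \<bar>L\<bar> * (exp (K * t) * (real (2 * k + 2) * (real (2 * k + 1) * x ^ (2 * k))))"
    using e by (intro mult_right_mono mult_nonneg_nonneg) auto
  moreover have "\<dots> = K * exp (K * t) * x ^ (2 * k)" unfolding K by (simp add: mult_ac)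
  moreover have "0 < 1 / (T - t)\<^sup>2" using assms by simp
  ultimately show ?thesis by linarith
qed

text \<open>Testing against \<open>w\<close> plus a small multiple of the barrier requires no doubling of
  variables, because \<open>w\<close> itself is smooth.\<close>

lemma comparison_with_smooth_supersolution:
  fixes v w :: "real \<times> real \<Rightarrow> real"
  assumes F: "\<And>a b. 0 \<le> b \<Longrightarrow> F (a + b) \<le> F a + L * b"
    and sub: "viscosity_subsolution F v"
    and contv: "continuous_on parabolic_domain v"
    and w: "C12_on parabolic_domain w wt wx wxx"
    and super: "\<And>p. p \<in> parabolic_domain \<Longrightarrow> v p \<le> w p \<or> F (wxx p) \<le> wt p"
    and growth: "\<And>T. T > 0 \<Longrightarrow> \<exists>C (k::nat). \<forall>t\<in>{0<..T}. \<forall>x. v (t, x) - w (t, x) \<le> C * (1 + \<bar>x\<bar> ^ k)"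
    and init: "\<And>x \<eta>. \<eta> > 0 \<Longrightarrow> eventually (\<lambda>p. v p \<le> w p + \<eta>) (at (0, x) within parabolic_domain)"
    and "p \<in> parabolic_domain"
  shows "v p \<le> w p"
proof (rule ccontr)
  assume "\<not> v p \<le> w p"
  obtain t1 x1 where p: "p = (t1, x1)" by (cases p)
  have "t1 > 0" using \<open>p \<in> parabolic_domain\<close> p by (auto simp: parabolic_domain_def)
  \<comment> \<open>Any time after \<open>t1\<close> would do: \<open>p\<close> must lie strictly
    before the blow-up of the barrier.\<close>
  define T where "T = t1 + 1"
  obtain C and k :: nat where C: "\<And>t x. 0 < t \<Longrightarrow> t \<le> T \<Longrightarrow> v (t, x) - w (t, x) \<le> C * (1 + \<bar>x\<bar> ^ k)"
    using growth[of T] \<open>t1 > 0\<close> unfolding T_def by fastforce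
  define K where "K = \<bar>L\<bar> * (real (2 * k + 2) * real (2 * k + 1))"
  have "0 \<le> K" by (simp add: K_def)
  define D where "D = {0<..<T} \<times> (UNIV :: real set)"
  have "open D" unfolding D_def by (intro open_Times) auto
  have Dsub: "D \<subseteq> parabolic_domain" by (auto simp: D_def parabolic_domain_def)
  have pD: "p \<in> D" using \<open>t1 > 0\<close> by (auto simp: D_def p T_def)
  let ?\<psi> = "barrier K k T"
  have \<psi>: "1 + x ^ (2 * k + 2) + 1 / (T - t) \<le> ?\<psi> (t, x)" if "(t, x) \<in> D" for t x
    using barrier_ge[OF \<open>0 \<le> K\<close>] that by (auto simp: D_def)
  have \<psi>': "1 < ?\<psi> (t, x)" "1 / (T - t) \<le> ?\<psi> (t, x)" "x ^ (2 * k + 2) \<le> ?\<psi> (t, x)" if "(t, x) \<in> D" for t x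
  proof -
    have "0 \<le> x ^ (2 * k + 2)" by (rule zero_le_even_power) simp
    moreover have "0 < 1 / (T - t)" using that by (auto simp: D_def)
    ultimately show "1 < ?\<psi> (t, x)" "1 / (T - t) \<le> ?\<psi> (t, x)" "x ^ (2 * k + 2) \<le> ?\<psi> (t, x)"
      using \<psi>[OF that] by linarith+
  qed
  have \<psi>pos: "0 < ?\<psi> q" if "q \<in> D" for q using \<psi>'(1)[of "fst q" "snd q"] that by auto
  \<comment> \<open>With this \<open>\<delta>\<close> the penalty at \<open>p\<close> uses up
    exactly half of the gap \<open>v p - w p\<close>, so that \<open>z p\<close> equals the other
    half \<open>M\<close>.\<close>
  define \<delta> where "\<delta> = (v p - w p) / (2 * ?\<psi> p)"
  have "\<delta> > 0" unfolding \<delta>_def using \<open>\<not> v p \<le> w p\<close> \<psi>pos[OF pD] by simp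
  define z where "z = (\<lambda>q. v q - (w q + \<delta> * ?\<psi> q))"
  define M where "M = (v p - w p) / 2"
  have "M > 0" using \<open>\<not> v p \<le> w p\<close> by (simp add: M_def)
  have zp: "z p = M" unfolding z_def \<delta>_def M_def using \<psi>pos[OF pD] by (simp add: field_simps)
  have C12\<phi>: "C12_on D (\<lambda>q. w q + \<delta> * ?\<psi> q)
     (\<lambda>q. wt q + \<delta> * (case q of (t, x) \<Rightarrow> K * exp (K * t) * (1 + x ^ (2 * k + 2)) + 1 / (T - t)\<^sup>2))
     (\<lambda>q. wx q + \<delta> * (case q of (t, x) \<Rightarrow> exp (K * t) * (real (2 * k + 2) * x ^ (2 * k + 1))))
     (\<lambda>q. wxx q + \<delta> * (case q of (t, x) \<Rightarrow>
        exp (K * t) * (real (2 * k + 2) * (real (2 * k + 1) * x ^ (2 * k)))))"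
    unfolding D_def
    by (intro C12_on_add C12_on_cmult C12_on_barrier C12_on_subset[OF w Dsub[unfolded D_def]])
  have contz: "continuous_on D z"
    unfolding z_def using C12\<phi> continuous_on_subset[OF contv Dsub]
    by (auto simp: C12_on_def intro!: continuous_on_diff)
  \<comment> \<open>The superlevel set \<open>S\<close> is shown to be compact, so that
    \<open>z\<close> attains its maximum over the unbounded strip \<open>D\<close>.\<close>
  define S where "S = {q \<in> D. M \<le> z q}"
  \<comment> \<open>Beyond \<open>R\<close> the term \<open>\<delta> * x ^ (2 * k + 2)\<close>
    dominates the growth bound on \<open>v - w\<close>. Up to \<open>R\<close> that bound is at most
    \<open>B\<close>, which keeps points of \<open>S\<close> at distance \<open>\<delta> / B\<close>
    from time \<open>T\<close>; the summand \<open>1\<close> makes \<open>B\<close> positive even if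
    \<open>C = 0\<close>.\<close>
  define R where "R = max 1 (2 * \<bar>C\<bar> / \<delta>)"
  define B where "B = \<bar>C\<bar> * (1 + R ^ k) + 1"
  have "R \<ge> 1" by (simp add: R_def)
  then have "B > 0" by (simp add: B_def add_nonneg_pos)
  have bnd: "\<bar>x\<bar> \<le> R" "t \<le> T - \<delta> / B" if q: "(t, x) \<in> S" for t x
  proof -
    have tD: "(t, x) \<in> D" and le: "M \<le> v (t, x) - w (t, x) - \<delta> * ?\<psi> (t, x)"
      using q by (auto simp: S_def z_def)
    then have t: "0 < t" "t < T" by (auto simp: D_def)
    have vw: "v (t, x) - w (t, x) \<le> \<bar>C\<bar> * (1 + \<bar>x\<bar> ^ k)"
      using C[of t x] t mult_right_mono[of C "\<bar>C\<bar>" "1 + \<bar>x\<bar> ^ k"] by fastforce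
    show xR: "\<bar>x\<bar> \<le> R"
    proof (rule ccontr)
      assume "\<not> \<bar>x\<bar> \<le> R"
      then have "1 \<le> \<bar>x\<bar>" "2 * \<bar>C\<bar> / \<delta> \<le> \<bar>x\<bar>" unfolding R_def by linarith+
      then have x: "1 \<le> \<bar>x\<bar>" "2 * \<bar>C\<bar> \<le> \<delta> * \<bar>x\<bar>"
        using \<open>\<delta> > 0\<close> by (simp_all add: pos_divide_le_eq mult.commute)
      have p1: "1 \<le> \<bar>x\<bar> ^ (2 * k + 1)" "\<bar>x\<bar> ^ k \<le> \<bar>x\<bar> ^ (2 * k + 1)"
        using x by (auto intro!: one_le_power power_increasing simp del: power_Suc power_add)
      have "\<bar>C\<bar> * (1 + \<bar>x\<bar> ^ k) \<le> \<bar>C\<bar> * (2 * \<bar>x\<bar> ^ (2 * k + 1))"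
        using p1 by (intro mult_left_mono) auto
      also have "\<dots> = (2 * \<bar>C\<bar>) * \<bar>x\<bar> ^ (2 * k + 1)" by simp
      also have "\<dots> \<le> (\<delta> * \<bar>x\<bar>) * \<bar>x\<bar> ^ (2 * k + 1)"
        using x by (intro mult_right_mono) auto
      also have "\<dots> = \<delta> * \<bar>x\<bar> ^ (2 * k + 2)" by simp
      also have "\<dots> = \<delta> * x ^ (2 * k + 2)" using power_even_abs[of "2 * k + 2" x] by simp
      also have "\<dots> \<le> \<delta> * ?\<psi> (t, x)" using \<open>\<delta> > 0\<close> \<psi>'(3)[OF tD] by (intro mult_left_mono) auto
      finally show False using vw le \<open>M > 0\<close> by linarith
    qed
    have "\<delta> * (1 / (T - t)) \<le> \<delta> * ?\<psi> (t, x)"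
      using \<psi>'(2)[OF tD] \<open>\<delta> > 0\<close> by (intro mult_left_mono) auto
    also have "\<dots> \<le> \<bar>C\<bar> * (1 + \<bar>x\<bar> ^ k)" using le vw \<open>M > 0\<close> by linarith
    also have "\<dots> \<le> \<bar>C\<bar> * (1 + R ^ k)"
      using xR by (intro mult_left_mono add_left_mono power_mono) auto
    finally have "\<delta> * (1 / (T - t)) \<le> B" by (simp add: B_def)
    then show "t \<le> T - \<delta> / B" using t \<open>B > 0\<close> by (simp add: field_simps)
  qed
  have "closed S"
    unfolding closed_limpt
  proof (intro allI impI)
    fix q assume q: "q islimpt S"
    obtain t x where qtx: "q = (t, x)" by (cases q)
    have "S \<subseteq> {0..T - \<delta> / B} \<times> UNIV" using bnd by (auto simp: S_def D_def)
    moreover have "closed ({0..T - \<delta> / B} \<times> (UNIV :: real set))" by (intro closed_Times) auto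
    ultimately have "q \<in> {0..T - \<delta> / B} \<times> UNIV"
      using q islimpt_subset closed_limpt by metis
    moreover have "\<delta> / B > 0" using \<open>\<delta> > 0\<close> \<open>B > 0\<close> by simp
    ultimately have t: "0 \<le> t" "t < T" unfolding qtx by auto
    have nt: "at q within S \<noteq> bot" using q by (simp add: trivial_limit_within)
    have evS: "eventually (\<lambda>q. q \<in> S) (at q within S)"
      by (simp add: eventually_at_filter)
    show "q \<in> S"
    proof (cases "t = 0")
      case True
      \<comment> \<open>A limit point at time \<open>0\<close> is impossible: on \<open>S\<close>
        the difference \<open>v - w\<close> exceeds \<open>M\<close>, while \<open>init\<close>
        bounds it by \<open>M / 2\<close> nearby.\<close>
      have "eventually (\<lambda>q. v q \<le> w q + M / 2) (at q within S)"
        using filter_leD[OF at_le init[of "M / 2" x], of S] \<open>M > 0\<close> Dsub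
        unfolding qtx True by (auto simp: S_def)
      then have "eventually (\<lambda>q. False) (at q within S)"
        using evS
      proof eventually_elim
        case (elim r)
        then have "0 < \<delta> * ?\<psi> r" using \<psi>pos[of r] \<open>\<delta> > 0\<close> by (simp add: S_def)
        then show ?case using elim \<open>M > 0\<close> by (auto simp: S_def z_def)
      qed
      then show ?thesis using nt by (simp add: trivial_limit_def[symmetric] eventually_False)
    next
      case False
      then have "q \<in> D" using t by (auto simp: D_def qtx)
      then have "(z \<longlongrightarrow> z q) (at q)"
        using contz \<open>open D\<close> by (simp add: continuous_on_eq_continuous_at isCont_def)
      then have "(z \<longlongrightarrow> z q) (at q within S)" by (rule tendsto_mono[OF at_le, rotated]) simp
      then have "M \<le> z q"
        using evS nt by (intro tendsto_lowerbound) (auto simp: S_def elim: eventually_mono)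
      then show ?thesis using \<open>q \<in> D\<close> by (simp add: S_def)
    qed
  qed
  moreover have "bounded S"
  proof (rule bounded_subset)
    show "S \<subseteq> {0..T} \<times> {-R..R}"
      using bnd(1) by (force simp: S_def D_def abs_le_iff)
    show "bounded ({0..T} \<times> {-R..R})" by (intro bounded_Times) auto
  qed
  ultimately have "compact S" by (simp add: compact_eq_bounded_closed)
  moreover have "p \<in> S" using pD zp by (simp add: S_def)
  moreover have "continuous_on S z" using contz by (rule continuous_on_subset) (auto simp: S_def)
  ultimately obtain q where q: "q \<in> S" "\<And>r. r \<in> S \<Longrightarrow> z r \<le> z q"
    using continuous_attains_sup[of S z] by blast
  \<comment> \<open>Points of \<open>D\<close> outside \<open>S\<close> have \<open>z\<close> below
    \<open>M\<close>, hence below the maximum over \<open>S\<close>.\<close>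
  have "\<forall>r\<in>D. z r \<le> z q"
    using q by (force simp: S_def)
  moreover have qD: "q \<in> D" using q by (simp add: S_def)
  ultimately have visc: "wt q + \<delta> * (case q of (t, x) \<Rightarrow>
        K * exp (K * t) * (1 + x ^ (2 * k + 2)) + 1 / (T - t)\<^sup>2)
      \<le> F (wxx q + \<delta> * (case q of (t, x) \<Rightarrow>
        exp (K * t) * (real (2 * k + 2) * (real (2 * k + 1) * x ^ (2 * k)))))"
    using sub[unfolded viscosity_subsolution_def, rule_format, OF conjI[OF \<open>open D\<close>
        conjI[OF Dsub conjI[OF qD conjI[OF C12\<phi>]]]]] unfolding z_def by blast
  obtain t x where qtx: "q = (t, x)" by (cases q)
  let ?\<psi>xx = "exp (K * t) * (real (2 * k + 2) * (real (2 * k + 1) * x ^ (2 * k)))"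
  have "0 \<le> x ^ (2 * k)" by (rule zero_le_even_power) simp
  then have "0 \<le> \<delta> * ?\<psi>xx" using \<open>\<delta> > 0\<close> by (intro mult_nonneg_nonneg) auto
  from F[OF this, of "wxx q"] visc
  have "wt q + \<delta> * (K * exp (K * t) * (1 + x ^ (2 * k + 2)) + 1 / (T - t)\<^sup>2)
      \<le> F (wxx q) + L * (\<delta> * ?\<psi>xx)"
    unfolding qtx by simp
  moreover have "\<delta> * (L * ?\<psi>xx) < \<delta> * (K * exp (K * t) * (1 + x ^ (2 * k + 2)) + 1 / (T - t)\<^sup>2)"
    using \<open>\<delta> > 0\<close> qD unfolding qtx D_def
    by (intro mult_strict_left_mono barrier_strict[OF _ _ K_def]) auto
  moreover have "L * (\<delta> * ?\<psi>xx) = \<delta> * (L * ?\<psi>xx)" by (rule mult.left_commute)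
  ultimately have "wt q < F (wxx q)" by linarith
  \<comment> \<open>Both alternatives of \<open>super\<close> now fail at \<open>q\<close>. The
    differential inequality is thus demanded only where \<open>v\<close> exceeds
    \<open>w\<close>.\<close>
  moreover have "w q < v q"
    using q(1) \<open>M > 0\<close> mult_pos_pos[OF \<open>\<delta> > 0\<close> \<psi>pos[OF qD]] by (auto simp: S_def z_def)
  ultimately show False using super[of q] qD Dsub by force
qed

section \<open>The step solution\<close>

text \<open>The operator is piecewise linear with slope \<open>l\<^sup>2 / 2\<close> on negative and
  \<open>u\<^sup>2 / 2\<close> on positive arguments; the third case is an increment that crosses
  the origin.\<close>

lemma G_heat_operator_increment:
  assumes "0 \<le> l" "l \<le> u" "0 \<le> b"
  shows "G_heat_operator l u a \<le> G_heat_operator l u (a + b)"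
    and "G_heat_operator l u (a + b) \<le> G_heat_operator l u a + u\<^sup>2 / 2 * b"
proof -
  have sq: "0 \<le> l\<^sup>2" "l\<^sup>2 \<le> u\<^sup>2" using assms by (auto intro: power_mono)
  consider "0 \<le> a" | "a < 0" "a + b < 0" | "a < 0" "0 \<le> a + b" by linarith
  then have "G_heat_operator l u a \<le> G_heat_operator l u (a + b) \<and>
      G_heat_operator l u (a + b) \<le> G_heat_operator l u a + u\<^sup>2 / 2 * b"
  proof cases
    case 1
    then show ?thesis
      using assms(3) mult_nonneg_nonneg[OF zero_le_power2[of u] assms(3)]
      by (simp add: G_heat_operator_def algebra_simps)
  next
    case 2
    then show ?thesis
      using mult_nonneg_nonneg[OF sq(1) assms(3)] mult_right_mono[OF sq(2) assms(3)]
      by (simp add: G_heat_operator_def algebra_simps)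
  next
    case 3
    then have "0 \<le> u\<^sup>2 * (a + b)" "0 \<le> l\<^sup>2 * (- a)" "l\<^sup>2 * (- a) \<le> u\<^sup>2 * (- a)"
      using sq by (auto intro!: mult_nonneg_nonneg mult_nonneg_nonpos mult_right_mono mult_right_mono_neg)
    then show ?thesis
      using 3 by (simp add: G_heat_operator_def algebra_simps)
  qed
  then show "G_heat_operator l u a \<le> G_heat_operator l u (a + b)"
    "G_heat_operator l u (a + b) \<le> G_heat_operator l u a + u\<^sup>2 / 2 * b" by auto
qed

lemma G_heat_operator_mono:
  assumes "0 \<le> l" "l \<le> u" "a \<le> b"
  shows "G_heat_operator l u a \<le> G_heat_operator l u b"
  using G_heat_operator_increment(1)[OF assms(1,2), of "b - a" a] assms(3) by simp

text \<open>Makes a step solution with a larger lower volatility \<open>s\<close> a subsolution of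
  the equation with lower volatility \<open>l\<close>.\<close>

lemma G_heat_operator_antimono_lower:
  assumes "0 \<le> l" "l \<le> s"
  shows "G_heat_operator s u a \<le> G_heat_operator l u a"
  using mult_right_mono[OF power_mono[OF assms(2,1), of 2], of "max (- a) 0"]
  by (simp add: G_heat_operator_def)

section \<open>Derivatives of the self-similar function and the classical equation\<close>

definition step_dt :: "real \<Rightarrow> real \<Rightarrow> real \<Rightarrow> real \<times> real \<Rightarrow> real" where
  "step_dt l u c = (\<lambda>(t, x). let y = (x - c) / sqrt t in
     2 / (u + l) * profile_density l u y * (- y / (2 * t)))"

definition step_dx :: "real \<Rightarrow> real \<Rightarrow> real \<Rightarrow> real \<times> real \<Rightarrow> real" where
  "step_dx l u c = (\<lambda>(t, x). let y = (x - c) / sqrt t in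
     2 / (u + l) * profile_density l u y * (1 / sqrt t))"

definition step_dxx :: "real \<Rightarrow> real \<Rightarrow> real \<Rightarrow> real \<times> real \<Rightarrow> real" where
  "step_dxx l u c = (\<lambda>(t, x). let y = (x - c) / sqrt t in
     2 / (u + l) * profile_density l u y * (max (- y) 0 / u\<^sup>2 - max y 0 / l\<^sup>2) / t)"

text \<open>Chain rule in the similarity variable \<open>(x - c) / sqrt t\<close>. For
  \<open>l > 0\<close> the derivative of the profile is continuously differentiable, so the second
  space derivative is continuous even across \<open>x = c\<close>.\<close>

lemma C12_on_step_function:
  assumes "l > 0" "u > 0"
  shows "C12_on parabolic_domain (G_heat_step_function l u c)
    (step_dt l u c) (step_dx l u c) (step_dxx l u c)"
  unfolding C12_on_def
proof (intro conjI ballI, goal_cases)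
  case (1 p)
  obtain t x where p: "p = (t, x)" by (cases p)
  have t: "t > 0" using 1 p by (auto simp: parabolic_domain_def)
  let ?y = "(x - c) / sqrt t"
  have "((\<lambda>s. (x - c) / sqrt s) has_real_derivative - ?y / (2 * t)) (at t)"
  proof -
    have "((\<lambda>s. (x - c) / sqrt s) has_real_derivative
        (0 * sqrt t - (x - c) * (inverse (sqrt t) / 2)) / (sqrt t * sqrt t)) (at t)"
      using t by (intro DERIV_divide DERIV_const DERIV_real_sqrt) auto
    then show ?thesis using t by (rule_tac DERIV_cong) (auto simp: field_simps)
  qed
  from DERIV_chain2[OF has_real_derivative_profile[OF assms] this]
  have "((\<lambda>s. G_heat_profile l u ((x - c) / sqrt s)) has_real_derivative step_dt l u c (t, x)) (at t)"
    by (simp add: step_dt_def Let_def mult_ac)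
  then have dt: "((\<lambda>s. G_heat_step_function l u c (s, x)) has_real_derivative step_dt l u c (t, x)) (at t)"
    by (rule has_field_derivative_transform_within_open[of _ _ _ "{0<..}"])
      (use t in \<open>auto simp: G_heat_step_function_def\<close>)
  have y: "((\<lambda>z. (z - c) / sqrt t) has_real_derivative 1 / sqrt t) (at x)"
    using DERIV_cdivide[OF DERIV_diff[OF DERIV_ident DERIV_const]] by fastforce
  from DERIV_chain2[OF has_real_derivative_profile[OF assms] y]
  have dx: "((\<lambda>z. G_heat_step_function l u c (t, z)) has_real_derivative step_dx l u c (t, x)) (at x)"
    using t by (simp add: G_heat_step_function_def step_dx_def Let_def)
  from DERIV_cmult_right[OF DERIV_cmult[OF DERIV_chain2[OF has_real_derivative_profile_density y]]]
  have "((\<lambda>z. 2 / (u + l) * profile_density l u ((z - c) / sqrt t) * (1 / sqrt t)) has_real_derivative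
      2 / (u + l) * (profile_density l u ?y * (max (- ?y) 0 / u\<^sup>2 - max ?y 0 / l\<^sup>2) * (1 / sqrt t))
        * (1 / sqrt t)) (at x)"
    by blast
  moreover have "2 / (u + l) * (profile_density l u ?y * (max (- ?y) 0 / u\<^sup>2 - max ?y 0 / l\<^sup>2) * (1 / sqrt t))
        * (1 / sqrt t) = step_dxx l u c (t, x)"
  proof -
    have r: "A * (P * Q * (1 / sqrt t)) * (1 / sqrt t) = A * P * Q / t" for A P Q :: real
      using t by simp
    show ?thesis unfolding r by (simp add: step_dxx_def Let_def)
  qed
  ultimately have "((\<lambda>z. step_dx l u c (t, z)) has_real_derivative step_dxx l u c (t, x)) (at x)"
    by (simp add: step_dx_def Let_def)
  with dt dx show ?case by (simp add: p)
next
  have kcont: "continuous_on parabolic_domain (\<lambda>p. f ((snd p - c) / sqrt (fst p)))"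
    if "continuous_on UNIV f" for f :: "real \<Rightarrow> real"
    by (rule continuous_on_compose2[OF that])
      (auto simp: parabolic_domain_def intro!: continuous_intros)
  note k = kcont[OF continuous_on_profile_density]
  {
    case 2
    have "continuous_on UNIV (G_heat_profile l u)"
      by (rule DERIV_continuous_on[OF has_field_derivative_at_within[OF has_real_derivative_profile[OF assms]]])
    from kcont[OF this] show ?case
      by (rule continuous_on_cong[THEN iffD1, OF refl, rotated])
        (auto simp: parabolic_domain_def G_heat_step_function_def)
  next
    case 3
    show ?case unfolding step_dt_def Let_def case_prod_beta
      by (intro continuous_intros k) (auto simp: parabolic_domain_def)
  next
    case 4
    show ?case unfolding step_dx_def Let_def case_prod_beta
      by (intro continuous_intros k) (auto simp: parabolic_domain_def)
  next
    case 5
    show ?case unfolding step_dxx_def Let_def case_prod_beta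
      using assms by (intro continuous_intros k) (auto simp: parabolic_domain_def)
  }
qed

text \<open>On each side of \<open>c\<close> the volatility selected by the sign of the second
  derivative is the one in the Gaussian exponent there. Its square cancels, and both sides become
  \<open>A * (- y / 2)\<close>.\<close>

lemma step_function_classical:
  assumes "l > 0" "u > 0" "p \<in> parabolic_domain"
  shows "G_heat_operator l u (step_dxx l u c p) = step_dt l u c p"
proof -
  obtain t x where p: "p = (t, x)" "t > 0" using assms(3) by (auto simp: parabolic_domain_def)
  define y where "y = (x - c) / sqrt t"
  define A where "A = 2 / (u + l) * profile_density l u y / t"
  have "A > 0" unfolding A_def using assms p profile_density_pos by simp
  have xx: "step_dxx l u c p = A * (max (- y) 0 / u\<^sup>2 - max y 0 / l\<^sup>2)"
    by (simp add: step_dxx_def p Let_def y_def[symmetric] A_def)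
  have t: "step_dt l u c p = A * (- y / 2)"
    unfolding step_dt_def p(1) case_prod_conv Let_def y_def[symmetric] A_def by simp
  show ?thesis
  proof (cases "0 \<le> y")
    case True
    then show ?thesis unfolding xx t G_heat_operator_def using \<open>A > 0\<close> assms
      by (simp add: max_def mult_le_0_iff divide_le_0_iff)
  next
    case False
    then have "0 \<le> A * (- y / u\<^sup>2)" using \<open>A > 0\<close> assms by (intro mult_nonneg_nonneg divide_nonneg_nonneg) auto
    with False show ?thesis unfolding xx t G_heat_operator_def using assms
      by (simp add: max_def)
  qed
qed

lemma step_dxx_nonneg:
  assumes "l > 0" "u > 0" "t > 0" "x \<le> c"
  shows "0 \<le> step_dxx l u c (t, x)"
proof -
  define y where "y = (x - c) / sqrt t"
  have "y \<le> 0" using assms by (simp add: y_def divide_le_0_iff)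
  then have "0 \<le> max (- y) 0 / u\<^sup>2 - max y 0 / l\<^sup>2" by (simp add: divide_le_0_iff)
  then show ?thesis
    using assms less_imp_le[OF profile_density_pos]
    unfolding step_dxx_def Let_def case_prod_conv y_def[symmetric]
    by (intro divide_nonneg_nonneg mult_nonneg_nonneg) auto
qed

text \<open>Left of the jump the second derivative is nonnegative; there the operators with lower
  volatilities \<open>0\<close> and \<open>u\<close> agree and are linear, so doubling preserves the
  equation.\<close>

lemma double_step_function_classical:
  assumes "u > 0" "t > 0" "x \<le> c"
  shows "G_heat_operator 0 u (2 * step_dxx u u c (t, x)) = 2 * step_dt u u c (t, x)"
  using step_function_classical[OF assms(1,1), of "(t, x)" c] step_dxx_nonneg[OF assms(1,1-3)] assms
  by (simp add: G_heat_operator_def parabolic_domain_def)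

section \<open>Bounds, continuity and initial datum of the step function\<close>

lemma step_function_sigma_0:
  assumes "u > 0" "p \<in> parabolic_domain"
  shows "G_heat_step_function 0 u c p = min 1 (2 * G_heat_step_function u u c p)"
    and "0 < s \<Longrightarrow> u / (u + s) * G_heat_step_function 0 u c p \<le> G_heat_step_function s u c p"
  using assms profile_sigma_0[OF assms(1)] by (auto simp: parabolic_domain_def G_heat_step_function_def)

lemma step_function_ge_half:
  assumes "u > 0" "t > 0" "c \<le> x"
  shows "1 / 2 \<le> G_heat_step_function u u c (t, x)"
  using mono_profile[OF assms(1,1), of 0 "(x - c) / sqrt t"] profile_0[OF assms(1,1)] assms
  by (simp add: G_heat_step_function_def)

lemma step_function_le_half:
  assumes "u > 0" "t > 0" "x \<le> c"
  shows "G_heat_step_function u u c (t, x) \<le> 1 / 2"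
  using mono_profile[OF assms(1,1), of "(x - c) / sqrt t" 0] profile_0[OF assms(1,1)] assms
  by (simp add: G_heat_step_function_def divide_le_0_iff)

lemma step_function_bounds:
  assumes "0 \<le> l" "u > 0"
  shows "0 \<le> G_heat_step_function l u c p" "G_heat_step_function l u c p \<le> 1"
proof -
  have "0 \<le> G_heat_profile l u y \<and> G_heat_profile l u y \<le> 1" for y
    using assms profile_nonneg[of l u y] profile_le_1[of l u y] profile_nonneg[of u u y] profile_sigma_0(1)[of u y]
    by (cases "l = 0") auto
  then show "0 \<le> G_heat_step_function l u c p" "G_heat_step_function l u c p \<le> 1"
    by (auto simp: G_heat_step_function_def indicator_def split: prod.split)
qed

lemma continuous_on_step_function:
  assumes "0 \<le> l" "u > 0"
  shows "continuous_on parabolic_domain (G_heat_step_function l u c)"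
proof (cases "l = 0")
  case True
  have "continuous_on parabolic_domain (\<lambda>p. min 1 (2 * G_heat_step_function u u c p))"
    using C12_on_step_function[OF assms(2,2), of c]
    by (intro continuous_intros) (auto simp: C12_on_def)
  then show ?thesis
    using step_function_sigma_0(1)[OF assms(2)] True by (simp cong: continuous_on_cong)
next
  case False
  then show ?thesis
    using C12_on_step_function[of l u c] assms by (auto simp: C12_on_def)
qed

text \<open>The numerator of the similarity variable tends to \<open>x - c\<close>, which is
  nonzero, while \<open>1 / sqrt t\<close> diverges; the limits of the profile at plus and minus
  infinity then apply.\<close>

lemma step_function_initial_limit_pos:
  assumes "l > 0" "u > 0"
  shows "c < x \<Longrightarrow> (G_heat_step_function l u c \<longlongrightarrow> 1) (at (0, x) within parabolic_domain)"
    and "x < c \<Longrightarrow> (G_heat_step_function l u c \<longlongrightarrow> 0) (at (0, x) within parabolic_domain)"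
proof -
  let ?F = "at (0, x) within parabolic_domain"
  have dom: "eventually (\<lambda>p. p \<in> parabolic_domain) ?F" by (simp add: eventually_at_filter)
  have id: "((\<lambda>p. p) \<longlongrightarrow> (0, x)) ?F" by (rule tendsto_ident_at)
  have num: "((\<lambda>p. snd p - c) \<longlongrightarrow> x - c) ?F"
    using tendsto_diff[OF tendsto_snd[OF id] tendsto_const] by simp
  have "((\<lambda>p. sqrt (fst p)) \<longlongrightarrow> 0) ?F"
    using tendsto_real_sqrt[OF tendsto_fst[OF id]] by simp
  then have inv: "LIM p ?F. inverse (sqrt (fst p)) :> at_top"
    by (rule filterlim_inverse_at_top) (use dom in eventually_elim, auto simp: parabolic_domain_def)
  have eq: "eventually (\<lambda>p. G_heat_profile l u ((snd p - c) * inverse (sqrt (fst p)))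
      = G_heat_step_function l u c p) ?F"
    using dom by eventually_elim (auto simp: parabolic_domain_def G_heat_step_function_def divide_inverse)
  {
    assume "c < x"
    then have "((\<lambda>p. G_heat_profile l u ((snd p - c) * inverse (sqrt (fst p)))) \<longlongrightarrow> 1) ?F"
      by (intro filterlim_compose[OF profile_at_top[OF assms]] filterlim_tendsto_pos_mult_at_top[OF num _ inv]) simp
    then show "(G_heat_step_function l u c \<longlongrightarrow> 1) ?F" using eq by (rule Lim_transform_eventually)
  next
    assume "x < c"
    then have "((\<lambda>p. G_heat_profile l u ((snd p - c) * inverse (sqrt (fst p)))) \<longlongrightarrow> 0) ?F"
      by (intro filterlim_compose[OF profile_at_bot[OF assms]] filterlim_tendsto_neg_mult_at_bot[OF num _ inv]) simp
    then show "(G_heat_step_function l u c \<longlongrightarrow> 0) ?F" using eq by (rule Lim_transform_eventually)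
  }
qed

lemma step_function_initial_limit:
  assumes "0 \<le> l" "u > 0"
  shows "c < x \<Longrightarrow> (G_heat_step_function l u c \<longlongrightarrow> 1) (at (0, x) within parabolic_domain)"
    and "x < c \<Longrightarrow> (G_heat_step_function l u c \<longlongrightarrow> 0) (at (0, x) within parabolic_domain)"
proof -
  let ?F = "at (0, x) within parabolic_domain"
  \<comment> \<open>The map \<open>min 1 (2 * a)\<close> fixes both limit values \<open>0\<close>
    and \<open>1\<close>.\<close>
  have red: "(G_heat_step_function 0 u c \<longlongrightarrow> min 1 (2 * a)) ?F"
    if "(G_heat_step_function u u c \<longlongrightarrow> a) ?F" for a
  proof -
    have "((\<lambda>p. min 1 (2 * G_heat_step_function u u c p)) \<longlongrightarrow> min 1 (2 * a)) ?F"
      by (intro tendsto_intros that)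
    moreover have "eventually (\<lambda>p. min 1 (2 * G_heat_step_function u u c p) = G_heat_step_function 0 u c p) ?F"
      using step_function_sigma_0(1)[OF assms(2)] by (simp add: eventually_at_filter)
    ultimately show ?thesis by (rule Lim_transform_eventually)
  qed
  show "c < x \<Longrightarrow> (G_heat_step_function l u c \<longlongrightarrow> 1) ?F"
    using step_function_initial_limit_pos(1)[of l u c x] red[OF step_function_initial_limit_pos(1)] assms
    by (cases "l = 0") auto
  show "x < c \<Longrightarrow> (G_heat_step_function l u c \<longlongrightarrow> 0) ?F"
    using step_function_initial_limit_pos(2)[of l u x c] red[OF step_function_initial_limit_pos(2)] assms
    by (cases "l = 0") auto
qed

text \<open>Where the datum is locally constant, the true limit is used. In the remaining cases, in
  particular at the jump, the envelopes are so wide that the global bounds \<open>0\<close> and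
  \<open>1\<close> suffice.\<close>

lemma step_function_attains_initial_value:
  assumes "0 \<le> l" "u > 0"
  shows "attains_initial_value (indicator {c<..}) (G_heat_step_function l u c)"
  unfolding attains_initial_value_def
proof (intro allI conjI)
  fix x
  let ?F = "at (0, x) within parabolic_domain" and ?U = "G_heat_step_function l u c"
  let ?g = "\<lambda>y. ereal (indicator {c<..} y)"
  show "?U (0, x) = indicator {c<..} x" by (simp add: G_heat_step_function_def)
  \<comment> \<open>The upper envelope equals \<open>1\<close> even at \<open>x = c\<close>, where
    the datum is \<open>0\<close>, because every neighbourhood reaches beyond
    \<open>c\<close>.\<close>
  have right: "\<exists>y>c. P y" if P: "eventually P (nhds x)" and cx: "c \<le> x" for P
  proof -
    obtain d where d: "d > 0" "\<forall>y. dist y x < d \<longrightarrow> P y"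
      using P unfolding eventually_nhds_metric by auto
    have "dist (x + d / 2) x < d" using d(1) by (simp add: dist_real_def)
    then have "P (x + d / 2)" using d(2) by simp
    then show ?thesis using cx d(1) by (intro exI[of _ "x + d / 2"]) auto
  qed
  show "Limsup ?F (\<lambda>p. ereal (?U p)) \<le> Limsup (nhds x) ?g"
  proof (cases "x < c")
    case True
    have "Limsup ?F (\<lambda>p. ereal (?U p)) \<le> ereal 0"
      unfolding Limsup_le_iff
      using order_tendstoD(2)[OF tendsto_ereal[OF step_function_initial_limit(2)[OF assms True]]] by blast
    also have "ereal 0 \<le> Limsup (nhds x) ?g"
      by (rule Limsup_greatest) (auto intro!: SUP_upper2[of x] dest: eventually_nhds_x_imp_x)
    finally show ?thesis .
  next
    case False
    have "Limsup ?F (\<lambda>p. ereal (?U p)) \<le> ereal 1"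
      by (rule Limsup_bounded) (use step_function_bounds(2)[OF assms] in auto)
    also have "ereal 1 \<le> Limsup (nhds x) ?g"
    proof (rule Limsup_greatest)
      fix P assume "eventually P (nhds x)"
      then obtain y where "y > c" "P y" using right False by force
      then show "ereal 1 \<le> (SUP y\<in>Collect P. ?g y)" by (intro SUP_upper2[of y]) auto
    qed
    finally show ?thesis .
  qed
  show "Liminf ?F (\<lambda>p. ereal (?U p)) \<ge> Liminf (nhds x) ?g"
  proof (cases "c < x")
    case True
    have "Liminf (nhds x) ?g \<le> ereal 1"
      by (rule Liminf_least) (auto intro!: INF_lower2[of x] dest: eventually_nhds_x_imp_x simp: indicator_def)
    also have "ereal 1 \<le> Liminf ?F (\<lambda>p. ereal (?U p))"
      unfolding le_Liminf_iff
      using order_tendstoD(1)[OF tendsto_ereal[OF step_function_initial_limit(1)[OF assms True]]] by blast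
    finally show ?thesis .
  next
    case False
    have "Liminf (nhds x) ?g \<le> ereal 0"
      by (rule Liminf_least) (use False in \<open>auto intro!: INF_lower2[of x] dest: eventually_nhds_x_imp_x\<close>)
    also have "ereal 0 \<le> Liminf ?F (\<lambda>p. ereal (?U p))"
      by (rule Liminf_bounded) (use step_function_bounds(1)[OF assms] in auto)
    finally show ?thesis .
  qed
qed

lemma step_function_polynomial_growth:
  assumes "0 \<le> l" "u > 0"
  shows "polynomial_growth (G_heat_step_function l u c)"
  unfolding polynomial_growth_def
proof (intro allI impI exI ballI)
  fix T t x :: real
  show "\<bar>G_heat_step_function l u c (t, x)\<bar> \<le> 1 * (1 + \<bar>x\<bar> ^ 0)"
    using step_function_bounds[OF assms, of c "(t, x)"] by simp
qed

section \<open>The viscosity inequalities for the step function\<close>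

lemma step_function_viscosity_subsolution:
  assumes "0 \<le> l" "l \<le> u" "u > 0"
  shows "viscosity_subsolution (G_heat_operator l u) (G_heat_step_function l u c)"
  unfolding viscosity_subsolution_def
proof (intro allI impI, elim conjE)
  fix N p \<phi> \<phi>t \<phi>x \<phi>xx
  let ?U = "G_heat_step_function l u c" and ?V = "G_heat_step_function u u c"
  assume N: "open N" "N \<subseteq> parabolic_domain" "p \<in> N" and \<phi>: "C12_on N \<phi> \<phi>t \<phi>x \<phi>xx"
    and max: "\<forall>q\<in>N. ?U q - \<phi> q \<le> ?U p - \<phi> p"
  have pdom: "p \<in> parabolic_domain" using N by auto
  obtain t x where p: "p = (t, x)" "t > 0" using pdom by (auto simp: parabolic_domain_def)
  show "\<phi>t p \<le> G_heat_operator l u (\<phi>xx p)"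
  proof (cases "l = 0")
    case False
    then have "l > 0" using assms by simp
    have *: "\<phi>t p = step_dt l u c p" "step_dxx l u c p \<le> \<phi>xx p"
      by (rule C12_on_touching[OF C12_on_step_function[OF \<open>l > 0\<close> \<open>u > 0\<close>] open_parabolic_domain pdom \<phi> N(1,3)];
          use max in blast)+
    then show ?thesis
      using step_function_classical[OF \<open>l > 0\<close> \<open>u > 0\<close> pdom, of c] G_heat_operator_mono[OF assms(1,2) *(2)] by simp
  next
    case True
    show ?thesis
    proof (cases "x < c")
      case xc: True
      \<comment> \<open>On this open set the minimum in the formula for lower volatility
        \<open>0\<close> is attained by the doubled function, so \<open>?U\<close> is smooth
        there.\<close>
      define M :: "(real \<times> real) set" where "M = {0<..} \<times> {..<c}"
      have M: "open M" "p \<in> M" "M \<subseteq> parabolic_domain"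
        using p xc by (auto simp: M_def parabolic_domain_def intro!: open_Times)
      have eq: "?U q = 2 * ?V q" if "q \<in> M" for q
      proof -
        have "?V q \<le> 1 / 2"
          using that step_function_le_half[OF assms(3), of "fst q" "snd q" c] by (auto simp: M_def)
        then show ?thesis
          using step_function_sigma_0(1)[OF assms(3), of q c] that M True by auto
      qed
      have "C12_on M (\<lambda>q. 2 * ?V q) (\<lambda>q. 2 * step_dt u u c q) (\<lambda>q. 2 * step_dx u u c q) (\<lambda>q. 2 * step_dxx u u c q)"
        by (intro C12_on_cmult C12_on_subset[OF C12_on_step_function[OF assms(3,3)] M(3)])
      note * = C12_on_touching[OF this M(1,2) \<phi> N(1,3)]
      have "\<phi>t p = 2 * step_dt u u c p" "2 * step_dxx u u c p \<le> \<phi>xx p"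
        by (rule *; use max eq M in auto)+
      then show ?thesis
        using double_step_function_classical[OF assms(3), of t x c] p xc
          G_heat_operator_mono[OF assms(1,2), of "2 * step_dxx u u c p" "\<phi>xx p"] True by simp
    next
      case False
      \<comment> \<open>On and to the right of the kink, \<open>?U\<close> is constant along the
        time line, which forces \<open>\<phi>t p = 0\<close>. For lower volatility \<open>0\<close>
        the operator is nonnegative, whatever \<open>\<phi>xx p\<close> is.\<close>
      have one: "?U (s, x) = 1" if "s > 0" for s
        using step_function_sigma_0(1)[OF assms(3), of "(s, x)" c]
          step_function_ge_half[OF assms(3) that, of c x] False that True
        by (auto simp: parabolic_domain_def)
      have "- \<phi>t p = 0"
      proof (rule time_derivative_at_max[OF N(1), of t x "\<lambda>q. - \<phi> q"])
        show "(t, x) \<in> N" using N p by simp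
        show "((\<lambda>s. - \<phi> (s, x)) has_real_derivative - \<phi>t p) (at t)"
          using \<phi> N p by (intro DERIV_minus) (auto simp: C12_on_def)
        show "- \<phi> (s, x) \<le> - \<phi> (t, x)" if "(s, x) \<in> N" for s
        proof -
          have "s > 0" using that N by (auto simp: parabolic_domain_def)
          then show ?thesis using max that one[of s] one[of t] p by force
        qed
      qed
      then show ?thesis using True by (simp add: G_heat_operator_def)
    qed
  qed
qed

text \<open>For lower volatility \<open>0\<close> the step function is the minimum of two smooth
  functions, \<open>2 * ?V\<close> and \<open>1\<close>. The one active at \<open>p\<close> touches
  it from above there, so the test function touches this smooth function from below; on the kink
  line the constant \<open>1\<close> serves.\<close>

lemma step_function_viscosity_supersolution:
  assumes "0 \<le> l" "l \<le> u" "u > 0"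
  shows "viscosity_supersolution (G_heat_operator l u) (G_heat_step_function l u c)"
  unfolding viscosity_supersolution_def
proof (intro allI impI, elim conjE)
  fix N p \<phi> \<phi>t \<phi>x \<phi>xx
  let ?U = "G_heat_step_function l u c" and ?V = "G_heat_step_function u u c"
  assume N: "open N" "N \<subseteq> parabolic_domain" "p \<in> N" and \<phi>: "C12_on N \<phi> \<phi>t \<phi>x \<phi>xx"
    and min: "\<forall>q\<in>N. ?U q - \<phi> q \<ge> ?U p - \<phi> p"
  have pdom: "p \<in> parabolic_domain" using N by auto
  obtain t x where p: "p = (t, x)" "t > 0" using pdom by (auto simp: parabolic_domain_def)
  \<comment> \<open>If \<open>w\<close> lies above \<open>?U\<close> with equality at
    \<open>p\<close>, then \<open>\<phi> - w\<close> has a local maximum at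
    \<open>p\<close>.\<close>
  have touch: "wt p = \<phi>t p" "\<phi>xx p \<le> wxx p"
    if "C12_on parabolic_domain w wt wx wxx" "w p = ?U p" "\<And>q. q \<in> N \<Longrightarrow> ?U q \<le> w q" for w wt wx wxx
  proof -
    have "\<phi> q - w q \<le> \<phi> p - w p" if "q \<in> N \<inter> parabolic_domain" for q
      using min that \<open>w p = ?U p\<close> \<open>\<And>q. q \<in> N \<Longrightarrow> ?U q \<le> w q\<close>[of q] by fastforce
    from C12_on_touching[OF \<phi> N(1,3) that(1) open_parabolic_domain pdom this]
    show "wt p = \<phi>t p" "\<phi>xx p \<le> wxx p" by blast+
  qed
  have F: "G_heat_operator l u (\<phi>xx p) \<le> G_heat_operator l u a" if "\<phi>xx p \<le> a" for a
    using G_heat_operator_mono[OF assms(1,2) that] .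
  show "\<phi>t p \<ge> G_heat_operator l u (\<phi>xx p)"
  proof (cases "l = 0")
    case False
    then have "l > 0" using assms by simp
    from touch[OF C12_on_step_function[OF this \<open>u > 0\<close>]] F[of "step_dxx l u c p"]
    show ?thesis using step_function_classical[OF \<open>l > 0\<close> \<open>u > 0\<close> pdom, of c] by auto
  next
    case True
    have min_eq: "?U q = min 1 (2 * ?V q)" if "q \<in> N" for q
      using step_function_sigma_0(1)[OF assms(3), of q c] that N True by auto
    show ?thesis
    proof (cases "x < c")
      case xc: True
      have "C12_on parabolic_domain (\<lambda>q. 2 * ?V q) (\<lambda>q. 2 * step_dt u u c q) (\<lambda>q. 2 * step_dx u u c q)
          (\<lambda>q. 2 * step_dxx u u c q)"
        by (intro C12_on_cmult C12_on_step_function assms)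
      moreover have "2 * ?V p = ?U p"
        using min_eq[OF N(3)] step_function_le_half[OF assms(3) p(2), of x c] xc p by simp
      ultimately have "2 * step_dt u u c p = \<phi>t p" "\<phi>xx p \<le> 2 * step_dxx u u c p"
        using touch[of "\<lambda>q. 2 * ?V q"] min_eq by auto
      then show ?thesis
        using double_step_function_classical[OF assms(3), of t x c] p xc
          F[of "2 * step_dxx u u c p"] True by simp
    next
      case False
      have "?U p = 1"
        using min_eq[OF N(3)] step_function_ge_half[OF assms(3) p(2), of c x] False p by simp
      then have "0 = \<phi>t p" "\<phi>xx p \<le> 0"
        using touch[OF C12_on_const[of parabolic_domain 1]] step_function_bounds(2)[OF assms(1,3)] by auto
      \<comment> \<open>The negative part carries weight \<open>0\<close>, so the operator vanishes
        at \<open>\<phi>xx p \<le> 0\<close>.\<close>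
      then show ?thesis using True by (simp add: G_heat_operator_def)
    qed
  qed
qed

section \<open>Uniqueness\<close>

text \<open>A local bound on \<open>g\<close> bounds its upper envelope, which turns the envelope
  condition into the form with \<open>\<eta>\<close> required by the comparison lemma.\<close>

lemma attains_initial_value_eventually_le:
  assumes "attains_initial_value g v" "eventually (\<lambda>y. g y \<le> a) (nhds x)" "\<eta> > 0"
  shows "eventually (\<lambda>p. v p \<le> a + \<eta>) (at (0, x) within parabolic_domain)"
proof -
  have "Limsup (at (0, x) within parabolic_domain) (\<lambda>p. ereal (v p)) \<le> Limsup (nhds x) (\<lambda>y. ereal (g y))"
    using assms(1) by (simp add: attains_initial_value_def)
  also have "\<dots> \<le> ereal a" using assms(2) by (intro Limsup_bounded) simp
  also have "\<dots> < ereal (a + \<eta>)" using assms(3) by simp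
  finally show ?thesis by (auto dest!: Limsup_lessD elim: eventually_mono)
qed

lemma attains_initial_value_eventually_ge:
  assumes "attains_initial_value g v" "eventually (\<lambda>y. a \<le> g y) (nhds x)" "\<eta> > 0"
  shows "eventually (\<lambda>p. a - \<eta> \<le> v p) (at (0, x) within parabolic_domain)"
proof -
  have "ereal (a - \<eta>) < ereal a" using assms(3) by simp
  also have "\<dots> \<le> Liminf (nhds x) (\<lambda>y. ereal (g y))" using assms(2) by (intro Liminf_bounded) simp
  also have "\<dots> \<le> Liminf (at (0, x) within parabolic_domain) (\<lambda>p. ereal (v p))"
    using assms(1) by (simp add: attains_initial_value_def)
  finally show ?thesis by (auto dest!: less_LiminfD elim: eventually_mono)
qed

lemma polynomial_growth_diff_bounded:
  assumes "polynomial_growth v" "\<And>p. \<bar>w p\<bar> \<le> B" "T > 0"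
  shows "\<exists>C (k::nat). \<forall>t\<in>{0<..T}. \<forall>x. v (t, x) - w (t, x) \<le> C * (1 + \<bar>x\<bar> ^ k)"
proof -
  obtain C and k :: nat where C: "\<forall>t\<in>{0..T}. \<forall>x. \<bar>v (t, x)\<bar> \<le> C * (1 + \<bar>x\<bar> ^ k)"
    using assms(1,3) unfolding polynomial_growth_def by blast
  have "v (t, x) - w (t, x) \<le> (C + B) * (1 + \<bar>x\<bar> ^ k)" if "t \<in> {0<..T}" for t x
  proof -
    have "0 \<le> B" using assms(2)[of "(t, x)"] by simp
    then have "B * 1 \<le> B * (1 + \<bar>x\<bar> ^ k)" by (intro mult_left_mono) auto
    moreover have "v (t, x) \<le> C * (1 + \<bar>x\<bar> ^ k)" using C that by (auto simp: abs_le_iff)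
    ultimately show ?thesis using assms(2)[of "(t, x)"] unfolding distrib_right abs_le_iff by linarith
  qed
  then show ?thesis by blast
qed

lemma polynomial_growth_uminus: "polynomial_growth v \<Longrightarrow> polynomial_growth (\<lambda>p. - v p)"
  by (simp add: polynomial_growth_def)

text \<open>Moving the jump is a translation in space, so continuity at \<open>(t, x)\<close>
  suffices. The upper bound uses \<open>a = - 1\<close>, the lower bound
  \<open>a = 1\<close>.\<close>

lemma step_function_shift_tendsto:
  assumes "0 \<le> l" "u > 0" "t > 0"
  shows "((\<lambda>\<epsilon>. G_heat_step_function l u (c + a * \<epsilon>) (t, x)) \<longlongrightarrow> G_heat_step_function l u c (t, x)) (at_right 0)"
proof -
  have "isCont (G_heat_step_function l u c) (t, x)"
    using continuous_on_step_function[OF assms(1,2), of c] open_parabolic_domain assms(3)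
    by (simp add: continuous_on_eq_continuous_at parabolic_domain_def)
  moreover have "((\<lambda>\<epsilon>. (t, x - a * \<epsilon>)) \<longlongrightarrow> (t, x - a * 0)) (at_right 0)"
    by (intro tendsto_intros)
  ultimately have "((\<lambda>\<epsilon>. G_heat_step_function l u c (t, x - a * \<epsilon>)) \<longlongrightarrow> G_heat_step_function l u c (t, x)) (at_right 0)"
    using isCont_tendsto_compose[where f = "\<lambda>\<epsilon>. (t, x - a * \<epsilon>)" and g = "G_heat_step_function l u c"
        and l = "(t, x)" and F = "at_right 0"] by simp
  moreover have "G_heat_step_function l u c (t, x - a * \<epsilon>) = G_heat_step_function l u (c + a * \<epsilon>) (t, x)" for \<epsilon>
    using assms by (simp add: G_heat_step_function_def diff_diff_eq algebra_simps)
  ultimately show ?thesis by simp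
qed

text \<open>Shifting the jump by \<open>\<epsilon>\<close> separates the semicontinuous envelopes of the initial data, which
  touch at the jump when \<open>\<epsilon> = 0\<close>.\<close>

lemma solution_le_shifted_step_function:
  assumes F: "\<And>a b. 0 \<le> b \<Longrightarrow> F (a + b) \<le> F a + L * b"
    and v: "viscosity_solution_Cauchy F (indicator {c<..}) v" "polynomial_growth v"
    and "s > 0" "u > 0" "\<epsilon> > 0" "a \<ge> 1"
    and super: "\<And>p. p \<in> parabolic_domain \<Longrightarrow> v p \<le> a * G_heat_step_function s u (c - \<epsilon>) p
      \<or> F (a * step_dxx s u (c - \<epsilon>) p) \<le> a * step_dt s u (c - \<epsilon>) p"
    and "p \<in> parabolic_domain"
  shows "v p \<le> a * G_heat_step_function s u (c - \<epsilon>) p"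
proof -
  let ?W = "G_heat_step_function s u (c - \<epsilon>)"
  have sol: "viscosity_subsolution F v" "continuous_on parabolic_domain v" "attains_initial_value (indicator {c<..}) v"
    using v(1) by (auto simp: viscosity_solution_Cauchy_def viscosity_solution_def)
  have W: "0 \<le> ?W q" "?W q \<le> 1" for q using step_function_bounds[of s u "c - \<epsilon>" q] assms by auto
  have B: "\<bar>a * ?W q\<bar> \<le> a" for q
    using W[of q] \<open>a \<ge> 1\<close> mult_left_le[of "?W q" a] by (simp add: abs_mult)
  show ?thesis
  proof (rule comparison_with_smooth_supersolution[OF F sol(1,2)
        C12_on_cmult[OF C12_on_step_function[OF \<open>s > 0\<close> \<open>u > 0\<close>]] super _ _ \<open>p \<in> parabolic_domain\<close>])
    show "\<exists>C (k::nat). \<forall>t\<in>{0<..T}. \<forall>x. v (t, x) - a * ?W (t, x) \<le> C * (1 + \<bar>x\<bar> ^ k)" if "T > 0" for T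
      by (rule polynomial_growth_diff_bounded[OF v(2) B that])
    show "eventually (\<lambda>q. v q \<le> a * ?W q + \<eta>) (at (0, x) within parabolic_domain)" if "\<eta> > 0" for x \<eta>
    proof (cases "x < c")
      case True
      have "eventually (\<lambda>y. indicator {c<..} y \<le> (0::real)) (nhds x)"
        using eventually_nhds_in_open[of "{..<c}" x] True by (auto elim: eventually_mono)
      from attains_initial_value_eventually_le[OF sol(3) this that] show ?thesis
      proof eventually_elim
        case (elim q)
        then show ?case using mult_nonneg_nonneg[of a "?W q"] W \<open>a \<ge> 1\<close> by fastforce
      qed
    next
      case False
      have "eventually (\<lambda>y. indicator {c<..} y \<le> (1::real)) (nhds x)" by (simp add: indicator_def)
      from attains_initial_value_eventually_le[OF sol(3) this, of "\<eta> / 2"]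
      have "eventually (\<lambda>q. v q \<le> 1 + \<eta> / 2) (at (0, x) within parabolic_domain)" using that by simp
      \<comment> \<open>Here the shift matters: every \<open>x \<ge> c\<close>, including the jump
        itself, lies strictly to the right of \<open>c - \<epsilon>\<close>.\<close>
      moreover have "(?W \<longlongrightarrow> 1) (at (0, x) within parabolic_domain)"
        using False assms by (intro step_function_initial_limit) auto
      then have "eventually (\<lambda>q. 1 - \<eta> / 2 < ?W q) (at (0, x) within parabolic_domain)"
        by (rule order_tendstoD(1)) (use that in simp)
      ultimately show ?thesis
      proof eventually_elim
        case (elim q)
        then show ?case using mult_right_mono[of 1 a "?W q"] W \<open>a \<ge> 1\<close> by fastforce
      qed
    qed
  qed
qed

text \<open>The comparison lemma is applied to \<open>- v\<close> and the negated step function,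
  with \<open>F a\<close> replaced by \<open>- F (- a)\<close>. The condition
  \<open>l \<le> s\<close> makes the step function a smooth subsolution, and now the jump moves to
  the right.\<close>

lemma solution_ge_shifted_step_function:
  assumes "0 \<le> l" "l \<le> s" "s > 0" "s \<le> u" "\<epsilon> > 0"
    and v: "viscosity_solution_Cauchy (G_heat_operator l u) (indicator {c<..}) v" "polynomial_growth v"
    and "p \<in> parabolic_domain"
  shows "G_heat_step_function s u (c + \<epsilon>) p \<le> v p"
proof -
  let ?W = "G_heat_step_function s u (c + \<epsilon>)"
  have "u > 0" "l \<le> u" using assms by auto
  have sol: "viscosity_supersolution (G_heat_operator l u) v" "continuous_on parabolic_domain v"
    "attains_initial_value (indicator {c<..}) v"
    using v(1) by (auto simp: viscosity_solution_Cauchy_def viscosity_solution_def)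
  have W: "0 \<le> ?W q" "?W q \<le> 1" for q using step_function_bounds[of s u "c + \<epsilon>" q] assms by auto
  then have B: "\<bar>- 1 * ?W q\<bar> \<le> 1" for q by simp
  \<comment> \<open>The factor \<open>- 1\<close> matches the scaling in
    \<open>C12_on_cmult\<close>.\<close>
  have "- v p \<le> - 1 * ?W p"
  proof (rule comparison_with_smooth_supersolution[OF _ viscosity_subsolution_uminus[OF sol(1)]
        continuous_on_minus[OF sol(2)] C12_on_cmult[OF C12_on_step_function[OF \<open>s > 0\<close> \<open>u > 0\<close>]]
        _ _ _ \<open>p \<in> parabolic_domain\<close>])
    show "- G_heat_operator l u (- (a + b)) \<le> - G_heat_operator l u (- a) + u\<^sup>2 / 2 * b" if "0 \<le> b" for a b
      using G_heat_operator_increment(2)[OF \<open>0 \<le> l\<close> \<open>l \<le> u\<close> that, of "- (a + b)"] by simp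
    show "- v q \<le> - 1 * ?W q \<or> - G_heat_operator l u (- (- 1 * step_dxx s u (c + \<epsilon>) q)) \<le> - 1 * step_dt s u (c + \<epsilon>) q"
      if "q \<in> parabolic_domain" for q
      using step_function_classical[OF \<open>s > 0\<close> \<open>u > 0\<close> that, of "c + \<epsilon>"]
        G_heat_operator_antimono_lower[OF \<open>0 \<le> l\<close> \<open>l \<le> s\<close>, of u "step_dxx s u (c + \<epsilon>) q"] by simp
    show "\<exists>C (k::nat). \<forall>t\<in>{0<..T}. \<forall>x. - v (t, x) - - 1 * ?W (t, x) \<le> C * (1 + \<bar>x\<bar> ^ k)" if "T > 0" for T
      by (rule polynomial_growth_diff_bounded[OF polynomial_growth_uminus[OF v(2)] B that])
    show "eventually (\<lambda>q. - v q \<le> - 1 * ?W q + \<eta>) (at (0, x) within parabolic_domain)" if "\<eta> > 0" for x \<eta>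
    proof (cases "c < x")
      case True
      have "eventually (\<lambda>y. (1::real) \<le> indicator {c<..} y) (nhds x)"
        using eventually_nhds_in_open[of "{c<..}" x] True by (auto elim: eventually_mono)
      from attains_initial_value_eventually_ge[OF sol(3) this that] show ?thesis
      proof eventually_elim
        case (elim q)
        then show ?case using W(2)[of q] by simp
      qed
    next
      case False
      have "eventually (\<lambda>y. (0::real) \<le> indicator {c<..} y) (nhds x)" by simp
      from attains_initial_value_eventually_ge[OF sol(3) this, of "\<eta> / 2"]
      have "eventually (\<lambda>q. 0 - \<eta> / 2 \<le> v q) (at (0, x) within parabolic_domain)" using that by simp
      moreover have "(?W \<longlongrightarrow> 0) (at (0, x) within parabolic_domain)"
        using False assms by (intro step_function_initial_limit) auto
      then have "eventually (\<lambda>q. ?W q < \<eta> / 2) (at (0, x) within parabolic_domain)"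
        by (rule order_tendstoD(2)) (use that in simp)
      ultimately show ?thesis by eventually_elim simp
    qed
  qed
  then show ?thesis by simp
qed

text \<open>The constant \<open>1\<close> solves the equation and dominates the initial datum. This
  a priori bound covers the region where the doubled step function need not be a
  supersolution.\<close>

lemma solution_le_1:
  assumes "0 \<le> l" "l \<le> u"
    and v: "viscosity_solution_Cauchy (G_heat_operator l u) (indicator {c<..}) v" "polynomial_growth v"
    and "p \<in> parabolic_domain"
  shows "v p \<le> 1"
proof -
  have sol: "viscosity_subsolution (G_heat_operator l u) v" "continuous_on parabolic_domain v"
    "attains_initial_value (indicator {c<..}) v"
    using v(1) by (auto simp: viscosity_solution_Cauchy_def viscosity_solution_def)
  show ?thesis
  proof (rule comparison_with_smooth_supersolution[OF G_heat_operator_increment(2)[OF assms(1,2)] sol(1,2)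
        C12_on_const _ _ _ \<open>p \<in> parabolic_domain\<close>])
    show "\<exists>C (k::nat). \<forall>t\<in>{0<..T}. \<forall>x. v (t, x) - 1 \<le> C * (1 + \<bar>x\<bar> ^ k)" if "T > 0" for T
      by (rule polynomial_growth_diff_bounded[OF v(2) _ that, of "\<lambda>_. 1" 1]) simp
    show "eventually (\<lambda>q. v q \<le> 1 + \<eta>) (at (0, x) within parabolic_domain)" if "\<eta> > 0" for x \<eta>
      by (rule attains_initial_value_eventually_le[OF sol(3) _ that]) (simp add: indicator_def)
  qed (simp_all add: G_heat_operator_def)
qed

section \<open>Squeezing a solution as the shift and the lower volatility vanish\<close>

lemma solution_le_step_function:
  assumes "0 \<le> l" "l \<le> u" "u > 0"
    and v: "viscosity_solution_Cauchy (G_heat_operator l u) (indicator {c<..}) v" "polynomial_growth v"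
    and "t > 0"
  shows "v (t, x) \<le> G_heat_step_function l u c (t, x)"
proof (rule tendsto_lowerbound)
  show "((\<lambda>\<epsilon>. G_heat_step_function l u (c + (- 1) * \<epsilon>) (t, x)) \<longlongrightarrow> G_heat_step_function l u c (t, x)) (at_right 0)"
    by (rule step_function_shift_tendsto) (use assms in auto)
  have dom: "(t, x) \<in> parabolic_domain" using \<open>t > 0\<close> by (simp add: parabolic_domain_def)
  note F = G_heat_operator_increment(2)[OF assms(1,2)]
  \<comment> \<open>The bound is proved for each fixed shift to the left; continuity in the position
    of the jump then lets \<open>\<epsilon>\<close> tend to \<open>0\<close>.\<close>
  have "v (t, x) \<le> G_heat_step_function l u (c - \<epsilon>) (t, x)" if "\<epsilon> > 0" for \<epsilon>
  proof (cases "l = 0")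
    case False
    then have "l > 0" using assms by simp
    have "v (t, x) \<le> 1 * G_heat_step_function l u (c - \<epsilon>) (t, x)"
      by (rule solution_le_shifted_step_function[OF F v \<open>l > 0\<close> \<open>u > 0\<close> that _ _ dom])
        (use step_function_classical[OF \<open>l > 0\<close> \<open>u > 0\<close>, of _ "c - \<epsilon>"] in auto)
    then show ?thesis by simp
  next
    case True
    note le1 = solution_le_1[OF assms(1,2) v]
    have "v (t, x) \<le> 2 * G_heat_step_function u u (c - \<epsilon>) (t, x)"
    proof (rule solution_le_shifted_step_function[OF F v \<open>u > 0\<close> \<open>u > 0\<close> that _ _ dom])
      fix q :: "real \<times> real" assume q: "q \<in> parabolic_domain"
      obtain r y where qry: "q = (r, y)" "r > 0" using q by (auto simp: parabolic_domain_def)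
      show "v q \<le> 2 * G_heat_step_function u u (c - \<epsilon>) q
          \<or> G_heat_operator l u (2 * step_dxx u u (c - \<epsilon>) q) \<le> 2 * step_dt u u (c - \<epsilon>) q"
      proof (cases "y \<le> c - \<epsilon>")
        case True
        then show ?thesis
          using double_step_function_classical[OF \<open>u > 0\<close> qry(2) True] \<open>l = 0\<close> qry by simp
      next
        case False
        \<comment> \<open>Beyond the shifted jump the doubled function is at least \<open>1\<close>,
          so the a priori bound gives the first alternative.\<close>
        then show ?thesis
          using step_function_ge_half[OF \<open>u > 0\<close> qry(2), of "c - \<epsilon>" y] le1[OF q] qry by simp
      qed
    qed simp_all
    \<comment> \<open>Combined with \<open>v \<le> 1\<close>, the doubled bound becomes a bound by
      the minimum, which is the step function itself.\<close>
    then show ?thesis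
      using step_function_sigma_0(1)[OF \<open>u > 0\<close> dom, of "c - \<epsilon>"] le1[OF dom] True by simp
  qed
  then show "eventually (\<lambda>\<epsilon>. v (t, x) \<le> G_heat_step_function l u (c + (- 1) * \<epsilon>) (t, x)) (at_right 0)"
    by (simp add: eventually_at_right_less eventually_mono[OF eventually_at_right_less])
qed simp

lemma step_function_le_solution:
  assumes "0 \<le> l" "l \<le> u" "u > 0"
    and v: "viscosity_solution_Cauchy (G_heat_operator l u) (indicator {c<..}) v" "polynomial_growth v"
    and "t > 0"
  shows "G_heat_step_function l u c (t, x) \<le> v (t, x)"
proof -
  have dom: "(t, x) \<in> parabolic_domain" using \<open>t > 0\<close> by (simp add: parabolic_domain_def)
  \<comment> \<open>First limit: the shift vanishes while a positive lower volatility
    \<open>s\<close> is kept fixed.\<close>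
  have le: "G_heat_step_function s u c (t, x) \<le> v (t, x)" if "l \<le> s" "0 < s" "s \<le> u" for s
  proof (rule tendsto_upperbound)
    show "((\<lambda>\<epsilon>. G_heat_step_function s u (c + 1 * \<epsilon>) (t, x)) \<longlongrightarrow> G_heat_step_function s u c (t, x)) (at_right 0)"
      by (rule step_function_shift_tendsto) (use assms that in auto)
    show "eventually (\<lambda>\<epsilon>. G_heat_step_function s u (c + 1 * \<epsilon>) (t, x) \<le> v (t, x)) (at_right 0)"
      using solution_ge_shifted_step_function[OF \<open>0 \<le> l\<close> that _ v dom]
      by (simp add: eventually_mono[OF eventually_at_right_less])
  qed simp
  show ?thesis
  proof (cases "l = 0")
    case False
    then show ?thesis using le[of l] assms by simp
  next
    case True
    show ?thesis
    \<comment> \<open>Second limit: \<open>s\<close> tends to \<open>0\<close>. After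
      \<open>step_function_sigma_0\<close>, the dependence on \<open>s\<close> sits only in the
      factor \<open>u / (u + s)\<close>.\<close>
    proof (rule tendsto_upperbound)
      have "((\<lambda>s. u / (u + s) * G_heat_step_function 0 u c (t, x))
          \<longlongrightarrow> u / (u + 0) * G_heat_step_function 0 u c (t, x)) (at_right 0)"
        using \<open>u > 0\<close> by (intro tendsto_intros) auto
      then show "((\<lambda>s. u / (u + s) * G_heat_step_function 0 u c (t, x))
          \<longlongrightarrow> G_heat_step_function l u c (t, x)) (at_right 0)"
        using True \<open>u > 0\<close> by simp
      show "eventually (\<lambda>s. u / (u + s) * G_heat_step_function 0 u c (t, x) \<le> v (t, x)) (at_right 0)"
        using eventually_at_right_real[OF \<open>u > 0\<close>]
      proof eventually_elim
        case (elim s)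
        then show ?case
          using step_function_sigma_0(2)[OF \<open>u > 0\<close> dom, of s c] le[of s] True by auto
      qed
    qed simp
  qed
qed

theorem theorem2:
  fixes \<sigma>\<^sub>l \<sigma>\<^sub>u c :: real
  assumes "0 \<le> \<sigma>\<^sub>l" and "\<sigma>\<^sub>l \<le> \<sigma>\<^sub>u" and "0 < \<sigma>\<^sub>u"
  shows "viscosity_solution_Cauchy (G_heat_operator \<sigma>\<^sub>l \<sigma>\<^sub>u) (indicator {c<..})
           (G_heat_step_function \<sigma>\<^sub>l \<sigma>\<^sub>u c) \<and>
         polynomial_growth (G_heat_step_function \<sigma>\<^sub>l \<sigma>\<^sub>u c) \<and>
         (\<forall>v. viscosity_solution_Cauchy (G_heat_operator \<sigma>\<^sub>l \<sigma>\<^sub>u) (indicator {c<..}) v \<and>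
              polynomial_growth v \<longrightarrow>
              (\<forall>t\<ge>0. \<forall>x. v (t, x) = G_heat_step_function \<sigma>\<^sub>l \<sigma>\<^sub>u c (t, x)))"
proof (intro conjI allI impI, goal_cases)
  case 1
  show ?case
    unfolding viscosity_solution_Cauchy_def viscosity_solution_def
    using assms by (intro conjI continuous_on_step_function step_function_viscosity_subsolution
      step_function_viscosity_supersolution step_function_attains_initial_value)
next
  case 2
  show ?case using assms by (intro step_function_polynomial_growth)
next
  case (3 v t x)
  show ?case
  proof (cases "t = 0")
    case True
    then show ?thesis
      using 3 by (simp add: viscosity_solution_Cauchy_def attains_initial_value_def G_heat_step_function_def)
  next
    case False
    then show ?thesis
      using 3 assms by (intro antisym solution_le_step_function step_function_le_solution) auto
  qed
qed

end
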